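(* Under the moment assumption stated in the context, when $\mathcal{H}_1:\ \bm{\Sigma}_x\bm{\Sigma}_y\neq\bm{\Sigma}_y\bm{\Sigma}_x$ is true, if $\sigma_{xxyy}-\sigma_{xyxy}>0$, then the test statistic $T$ defined in the context satisfies $$\mathrm{P}(T>C)\to1$$ for any positive constant $C$, as $p\to\infty$ with $m,n\asymp p^\delta$, $1/2<\delta<1$.
   Context: Let $p$ be a positive integer tending to infinity; for each $p$ let $m,n$ be positive integers and $\bm{\Sigma}_x,\bm{\Sigma}_y$ be $p\times p$ (symmetric) positive definite matrices, all depending on $p$. The notation $n\asymp p^\delta$ means that $n/p^\delta$ is bounded above and bounded away from zero by positive constants; $\delta$ is fixed. Data: a random sample of size $M=4m$ from $N_p(\bm{\mu}_x,\bm{\Sigma}_x)$, randomly split into four subsamples of size $m$, and, independently, a random sample of size $N=4n$ from $N_p(\bm{\mu}_y,\bm{\Sigma}_y)$, split into four subsamples of size $n$. The scatter matrix of a sample $\bm{v}_1,\dots,\bm{v}_k$ is $\sum_{i=1}^k(\bm{v}_i-\bar{\bm{v}})(\bm{v}_i-\bar{\bm{v}})'$. Let $\bm{T}_{x1},\dots,\bm{T}_{x4}$ and $\bm{T}_{y1},\dots,\bm{T}_{y4}$ be the scatter matrices of the subsamples; they are independent with $\bm{T}_{xk}\sim W_p(m-1,\bm{\Sigma}_x)$ and $\bm{T}_{yk}\sim W_p(n-1,\bm{\Sigma}_y)$ (Wishart distributions). Let $\bm{S}_x$ and $\bm{S}_y$ be the scatter matrices of the two whole samples (before splitting) divided by $M-1$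 and $N-1$, respectively. Define $$\hat\theta=\frac{1}{(m-1)^2(n-1)^2p}\left\{\mathrm{tr}(\bm{T}_{x1}\bm{T}_{x2}\bm{T}_{y1}\bm{T}_{y2})-\mathrm{tr}(\bm{T}_{x3}\bm{T}_{y3}\bm{T}_{x4}\bm{T}_{y4})\right\},$$ $$\hat\sigma_{xx}=\frac{(M-1)^2}{p(M-2)(M+1)}\left[\mathrm{tr}(\bm{S}_x\bm{S}_x)-\frac{\{\mathrm{tr}(\bm{S}_x)\}^2}{M-1}\right],\quad \hat\sigma_{yy}=\frac{(N-1)^2}{p(N-2)(N+1)}\left[\mathrm{tr}(\bm{S}_y\bm{S}_y)-\frac{\{\mathrm{tr}(\bm{S}_y)\}^2}{N-1}\right],$$ $$\hat\sigma_{xy}=\frac1p\mathrm{tr}(\bm{S}_x\bm{S}_y),\qquad T=\frac{(m-1)(n-1)}{p}\,\frac{\hat\theta}{\sqrt{\hat\sigma_{xx}\hat\sigma_{yy}\hat\sigma_{xy}^2+\hat\sigma_{xy}^4}}.$$ Moment assumption: as $p\to\infty$ with $m,n\asymp p^\delta$, for every $k\in\{2,\dots,16\}$ and all $i_1,\dots,i_k\in\{x,y\}$ the limit $\sigma_{i_1\cdots i_k}=\lim_{p\to\infty}\mathrm{tr}(\bm{\Sigma}_{i_1}\cdots\bm{\Sigma}_{i_k})/p$ exists, with $\sigma_{i_1\cdots i_k}\in(0,\infty)$ for $2\le k\le5$ and $\sigma_{i_1\cdots i_k}\in(-\infty,\infty)$ for $6\le k\le16$. In particular $\sigma_{xxyy}=\lim\mathrm{tr}(\bm{\Sigma}_x\bm{\Sigma}_x\bm{\Sigma}_y\bm{\Sigma}_y)/p$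 and $\sigma_{xyxy}=\lim\mathrm{tr}(\bm{\Sigma}_x\bm{\Sigma}_y\bm{\Sigma}_x\bm{\Sigma}_y)/p$. *)

theory Defs
  imports
    "HOL-Probability.Probability"
    "HOL-Library.Landau_Symbols"
    "Jordan_Normal_Form.Matrix"
begin

(* The dimension p varies along the limit, so vectors and matrices are those of Jordan_Normal_Form
   (dimension a value, not a type); "$" below is its vector indexing. *)
unbundle no vec_syntax
notation vec_index (infixl "$" 100)

definition mat_trace :: "real mat \<Rightarrow> real" where
  "mat_trace A = (\<Sum>i<dim_row A. A $$ (i, i))"

definition pos_def :: "nat \<Rightarrow> real mat \<Rightarrow> bool" where
  "pos_def p A \<longleftrightarrow> A \<in> carrier_mat p p \<and> transpose_mat A = A \<and>
     (\<forall>a \<in> carrier_vec p. a \<noteq> 0\<^sub>v p \<longrightarrow> a \<bullet> (A *\<^sub>v a) > 0)"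

(* The Borel sigma-algebra of R^p, transported to the carrier set of p-dimensional vectors. *)
definition borel_vec :: "nat \<Rightarrow> real vec measure" where
  "borel_vec p = vimage_algebra (carrier_vec p) (\<lambda>v. \<lambda>i\<in>{..<p}. v $ i)
     (\<Pi>\<^sub>M i\<in>{..<p}. (borel :: real measure))"

(* Z has the distribution N_p(mu, Sigma) for positive definite Sigma: every nontrivial linear
   combination a'Z is N(a'mu, a'Sigma a) (the definition of Rao and Muirhead).
   The library's normal_density takes the standard deviation. *)
definition mv_normal ::
  "'w measure \<Rightarrow> nat \<Rightarrow> real vec \<Rightarrow> real mat \<Rightarrow> ('w \<Rightarrow> real vec) \<Rightarrow> bool" where
  "mv_normal P p \<mu> \<Sigma> Z \<longleftrightarrow>
     Z \<in> P \<rightarrow>\<^sub>M borel_vec p \<and>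
     (\<forall>a \<in> carrier_vec p. a \<noteq> 0\<^sub>v p \<longrightarrow>
        distributed P lborel (\<lambda>\<omega>. a \<bullet> Z \<omega>)
          (normal_density (a \<bullet> \<mu>) (sqrt (a \<bullet> (\<Sigma> *\<^sub>v a)))))"

(* The ways of splitting 4k observations, indexed by {..<4k}, into four labelled subsamples of
   size k: s i is the label of the subsample that receives observation i. *)
definition splits :: "nat \<Rightarrow> (nat \<Rightarrow> nat) set" where
  "splits k = {s \<in> {..<4 * k} \<rightarrow>\<^sub>E {1..4}. \<forall>l\<in>{1..4}. card {i \<in> {..<4 * k}. s i = l} = k}"

definition subsample :: "nat \<Rightarrow> (nat \<Rightarrow> nat) \<Rightarrow> nat \<Rightarrow> nat set" where
  "subsample k s l = {i \<in> {..<4 * k}. s i = l}"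

(* The data for one p: X_0, ..., X_{4m-1} iid N_p(mu_x, Sigma_x) and Y_0, ..., Y_{4n-1} iid
   N_p(mu_y, Sigma_y), all independent, together with splits s and t of the two samples that are
   chosen uniformly at random, independently of each other and of the data (indep_set on the
   generated sigma-algebras, as the library's indep_var needs both variables to have the same type). *)
definition split_normal_samples ::
  "'w measure \<Rightarrow> nat \<Rightarrow> nat \<Rightarrow> nat \<Rightarrow> real vec \<Rightarrow> real mat \<Rightarrow> real vec \<Rightarrow> real mat \<Rightarrow>
   (nat \<Rightarrow> 'w \<Rightarrow> real vec) \<Rightarrow> (nat \<Rightarrow> 'w \<Rightarrow> real vec) \<Rightarrow>
   ('w \<Rightarrow> nat \<Rightarrow> nat) \<Rightarrow> ('w \<Rightarrow> nat \<Rightarrow> nat) \<Rightarrow> bool" where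
  "split_normal_samples P p m n \<mu>x \<Sigma>x \<mu>y \<Sigma>y X Y s t \<longleftrightarrow>
     prob_space P \<and>
     (\<forall>i<4 * m. mv_normal P p \<mu>x \<Sigma>x (X i)) \<and>
     (\<forall>i<4 * n. mv_normal P p \<mu>y \<Sigma>y (Y i)) \<and>
     prob_space.indep_vars P (\<lambda>_. borel_vec p) (case_sum X Y) ({..<4 * m} <+> {..<4 * n}) \<and>
     (\<lambda>\<omega>. (s \<omega>, t \<omega>)) \<in> P \<rightarrow>\<^sub>M count_space (splits m \<times> splits n) \<and>
     distr P (count_space (splits m \<times> splits n)) (\<lambda>\<omega>. (s \<omega>, t \<omega>)) =
       uniform_count_measure (splits m \<times> splits n) \<and>
     prob_space.indep_set P
       {(\<lambda>\<omega>. (s \<omega>, t \<omega>)) -` A \<inter> space P | A. A \<subseteq> splits m \<times> splits n}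
       {(\<lambda>\<omega>. \<lambda>i\<in>{..<4 * m} <+> {..<4 * n}. case_sum X Y i \<omega>) -` B \<inter> space P | B.
          B \<in> sets (\<Pi>\<^sub>M i\<in>{..<4 * m} <+> {..<4 * n}. borel_vec p)}"

definition sample_mean :: "nat \<Rightarrow> nat set \<Rightarrow> (nat \<Rightarrow> real vec) \<Rightarrow> real vec" where
  "sample_mean p I v = vec p (\<lambda>a. (\<Sum>i\<in>I. v i $ a) / real (card I))"

definition scatter :: "nat \<Rightarrow> nat set \<Rightarrow> (nat \<Rightarrow> real vec) \<Rightarrow> real mat" where
  "scatter p I v = mat p p (\<lambda>(a, b).
     \<Sum>i\<in>I. (v i $ a - sample_mean p I v $ a) * (v i $ b - sample_mean p I v $ b))"

(* The sample covariance matrix of the whole sample of size K. *)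
definition sample_cov :: "nat \<Rightarrow> nat \<Rightarrow> (nat \<Rightarrow> real vec) \<Rightarrow> real mat" where
  "sample_cov p K v = (1 / (real K - 1)) \<cdot>\<^sub>m scatter p {..<K} v"

definition theta_hat ::
  "nat \<Rightarrow> nat \<Rightarrow> nat \<Rightarrow> (nat \<Rightarrow> real mat) \<Rightarrow> (nat \<Rightarrow> real mat) \<Rightarrow> real" where
  "theta_hat p m n Tx Ty =
     1 / ((real m - 1)\<^sup>2 * (real n - 1)\<^sup>2 * real p) *
     (mat_trace (Tx 1 * Tx 2 * Ty 1 * Ty 2) - mat_trace (Tx 3 * Ty 3 * Tx 4 * Ty 4))"

(* sigma_xx-hat (K = M, S = S_x) and sigma_yy-hat (K = N, S = S_y). *)
definition sigma_hat_sq :: "nat \<Rightarrow> nat \<Rightarrow> real mat \<Rightarrow> real" where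
  "sigma_hat_sq p K S =
     (real K - 1)\<^sup>2 / (real p * (real K - 2) * (real K + 1)) *
     (mat_trace (S * S) - (mat_trace S)\<^sup>2 / (real K - 1))"

definition sigma_hat_xy :: "nat \<Rightarrow> real mat \<Rightarrow> real mat \<Rightarrow> real" where
  "sigma_hat_xy p Sx Sy = mat_trace (Sx * Sy) / real p"

(* The statistic T as a function of the observations v, w and the splits s, t. *)
definition test_stat ::
  "nat \<Rightarrow> nat \<Rightarrow> nat \<Rightarrow> (nat \<Rightarrow> real vec) \<Rightarrow> (nat \<Rightarrow> real vec) \<Rightarrow>
   (nat \<Rightarrow> nat) \<Rightarrow> (nat \<Rightarrow> nat) \<Rightarrow> real" where
  "test_stat p m n v w s t =
    (let Tx = (\<lambda>l. scatter p (subsample m s l) v);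
         Ty = (\<lambda>l. scatter p (subsample n t l) w);
         Sx = sample_cov p (4 * m) v;
         Sy = sample_cov p (4 * n) w;
         sxx = sigma_hat_sq p (4 * m) Sx;
         syy = sigma_hat_sq p (4 * n) Sy;
         sxy = sigma_hat_xy p Sx Sy
     in (real m - 1) * (real n - 1) / real p *
        (theta_hat p m n Tx Ty / sqrt (sxx * syy * sxy\<^sup>2 + sxy ^ 4)))"

datatype population = PX | PY

(* Sigma_{i_1} ... Sigma_{i_k} for a word i_1 ... i_k in the two populations. *)
fun word_prod :: "nat \<Rightarrow> real mat \<Rightarrow> real mat \<Rightarrow> population list \<Rightarrow> real mat" where
  "word_prod p \<Sigma>x \<Sigma>y [] = 1\<^sub>m p"
| "word_prod p \<Sigma>x \<Sigma>y (PX # w) = \<Sigma>x * word_prod p \<Sigma>x \<Sigma>y w"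
| "word_prod p \<Sigma>x \<Sigma>y (PY # w) = \<Sigma>y * word_prod p \<Sigma>x \<Sigma>y w"

(* The limits of the normalised traces for words of length 2 to 16 exist and are the real numbers
   given by sigma, positive for words of length at most 5. *)
definition moment_assumption ::
  "(nat \<Rightarrow> real mat) \<Rightarrow> (nat \<Rightarrow> real mat) \<Rightarrow> (population list \<Rightarrow> real) \<Rightarrow> bool" where
  "moment_assumption \<Sigma>x \<Sigma>y \<sigma> \<longleftrightarrow>
     (\<forall>w. 2 \<le> length w \<and> length w \<le> 16 \<longrightarrow>
        (\<lambda>p. mat_trace (word_prod p (\<Sigma>x p) (\<Sigma>y p) w) / real p) \<longlonglongrightarrow> \<sigma> w) \<and>
     (\<forall>w. 2 \<le> length w \<and> length w \<le> 5 \<longrightarrow> \<sigma> w > 0)"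

end

theory Submission
  imports Defs "HOL-Real_Asymp.Real_Asymp"
begin

text \<open>
  Only the first two moments of the scatter matrices matter. Dividing by the degrees of freedom k gives
  matrices with mean \<Sigma> whose entries have covariances of order 1/k. Replacing the four factors of a trace
  by their means one at a time, with p-normalised traces of words bounded by K and \<kappa> of order p^(-\<delta>), the
  squared L2 error of the p-normalised trace is of order \<kappa> K p (2 + \<kappa> K p)^3 / p^2, hence of order p^(2 - 4 \<delta>),
  which vanishes for \<delta> > 1/2. So the estimator of the gap converges in probability to a positive limit; the
  estimators under the root are nonnegative with bounded mean (sigma-xx, sigma-yy) or converge to a
  positive limit (sigma-xy). Letting the bound allowed for the former grow like p^(\<delta> - 1/2), the factor
  (m - 1)(n - 1)/p, of order p^(2 \<delta> - 1), still drives the statistic to infinity. All bounds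
  are uniform over fixed splits, so that the random splits can be conditioned on.
\<close>

section \<open>Traces and positive semidefinite matrices\<close>

text \<open>In each trace a random factor occurs once, so in the square of a trace it occurs twice;
  this is why second moments of single factors suffice. Once the centred factor has been integrated
  out, tr(S N S N') remains, with N the product of the other factors: a nested sandwich around a
  fixed matrix. Its outermost random factor B, with mean S, is integrated out by E tr(Q B N B) = (1
  + \<kappa>) tr(Q S N S) + \<kappa> tr(Q S) tr(S N). Both terms have the old shape with one random
  factor fewer, and the cost is the factor 2 + \<kappa> K p. The obstacle is the product of two
  traces: \<kappa> K p is of order p^(1 - \<delta>) and diverges for \<delta> < 1, so what
  accumulates over four factors has to be beaten by 1/p^2. Positivity keeps the recursion going. The
  inner sandwich is positive semidefinite at every point and is only ever traced against a matrix of
  the dual cone, so bounds apply under the integral, and nonnegative integrals dispense with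
  integrability of products of several random matrices.\<close>

lemma mult_entry:
  assumes "A \<in> carrier_mat p p" "B \<in> carrier_mat p p" "i < p" "j < p"
  shows "(A * B) $$ (i, j) = (\<Sum>k<p. A $$ (i, k) * (B $$ (k, j) :: real))"
  using assms by (auto simp: scalar_prod_def atLeast0LessThan intro!: sum.cong)

lemma mat_trace_mult:
  assumes "A \<in> carrier_mat p p" "B \<in> carrier_mat p p"
  shows "mat_trace (A * B) = (\<Sum>i<p. \<Sum>j<p. A $$ (i, j) * B $$ (j, i))"
  unfolding mat_trace_def using assms
  by (intro sum.cong) (auto simp: mult_entry[where p = p] carrier_matD simp del: index_mult_mat(1))

lemma mat_trace_comm:
  assumes "A \<in> carrier_mat p p" "B \<in> carrier_mat p p"
  shows "mat_trace (A * B) = mat_trace (B * A)"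
  unfolding mat_trace_mult[OF assms] mat_trace_mult[OF assms(2,1)]
  by (subst sum.swap) (simp add: mult.commute)

lemma mat_trace_transpose:
  assumes "A \<in> carrier_mat p p"
  shows "mat_trace (transpose_mat A) = mat_trace A"
  using assms by (auto simp: mat_trace_def)

lemma mat_trace_diff:
  assumes "A \<in> carrier_mat p p" "B \<in> carrier_mat p p"
  shows "mat_trace (A - B) = mat_trace A - mat_trace B"
  using assms by (auto simp: mat_trace_def sum_subtractf)

lemma mat_trace_smult:
  assumes "A \<in> carrier_mat p p"
  shows "mat_trace (c \<cdot>\<^sub>m A) = c * mat_trace A"
  using assms by (auto simp: mat_trace_def sum_distrib_left)

lemma mat_trace_mult4:
  assumes "A \<in> carrier_mat p p" "B \<in> carrier_mat p p" "C \<in> carrier_mat p p" "D \<in> carrier_mat p p"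
  shows "mat_trace (A * B * C * D) =
    (\<Sum>(a, b, c, d)\<in>{..<p} \<times> {..<p} \<times> {..<p} \<times> {..<p}. A $$ (a, b) * B $$ (b, c) * C $$ (c, d) * D $$ (d, a))"
proof -
  have "mat_trace (A * B * C * D) = mat_trace ((A * B) * (C * D))"
    using assms by (simp add: assoc_mult_mat[where ?n\<^sub>1.0 = p and ?n\<^sub>2.0 = p and ?n\<^sub>3.0 = p and ?n\<^sub>4.0 = p])
  also have "\<dots> = (\<Sum>a<p. \<Sum>c<p. (\<Sum>b<p. A $$ (a, b) * B $$ (b, c)) * (\<Sum>d<p. C $$ (c, d) * D $$ (d, a)))"
    using assms by (subst mat_trace_mult[of _ p]) (auto simp: mult_entry[where p = p] simp del: index_mult_mat(1) intro!: sum.cong)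
  also have "\<dots> = (\<Sum>a<p. \<Sum>c<p. \<Sum>b<p. \<Sum>d<p. A $$ (a, b) * B $$ (b, c) * C $$ (c, d) * D $$ (d, a))"
    by (simp add: sum_product mult.assoc)
  also have "\<dots> = (\<Sum>a<p. \<Sum>b<p. \<Sum>c<p. \<Sum>d<p. A $$ (a, b) * B $$ (b, c) * C $$ (c, d) * D $$ (d, a))"
    by (intro sum.cong refl sum.swap)
  finally show ?thesis
    by (simp add: sum.cartesian_product)
qed

definition psd :: "nat \<Rightarrow> real mat \<Rightarrow> bool" where
  "psd p M \<longleftrightarrow> M \<in> carrier_mat p p \<and> transpose_mat M = M \<and> (\<forall>v\<in>carrier_vec p. 0 \<le> v \<bullet> (M *\<^sub>v v))"

text \<open>
  The dual cone of the cone of positive semidefinite matrices. Stating positivity this way avoids factorizing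
  positive semidefinite matrices: a covariance matrix lies in the dual cone since it is the mean of z z'.
\<close>

definition trace_pos :: "nat \<Rightarrow> real mat \<Rightarrow> bool" where
  "trace_pos p Q \<longleftrightarrow> Q \<in> carrier_mat p p \<and> transpose_mat Q = Q \<and> (\<forall>M. psd p M \<longrightarrow> 0 \<le> mat_trace (Q * M))"

lemma transpose_sandwich:
  assumes "A \<in> carrier_mat p p" "M \<in> carrier_mat p p" "transpose_mat M = M"
  shows "transpose_mat (A * M * transpose_mat A) = A * M * transpose_mat (A :: real mat)"
  using assms
  by (simp add: transpose_mult[of _ p p _ p] assoc_mult_mat[of _ p p _ p _ p])

lemma psd_sandwich:
  assumes "psd p M" "A \<in> carrier_mat p p"
  shows "psd p (A * M * transpose_mat A)"
proof -
  have M: "M \<in> carrier_mat p p" "transpose_mat M = M"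
    using assms(1) by (auto simp: psd_def)
  have "0 \<le> v \<bullet> ((A * M * transpose_mat A) *\<^sub>v v)" if v: "v \<in> carrier_vec p" for v
  proof -
    let ?w = "transpose_mat A *\<^sub>v v"
    have w: "?w \<in> carrier_vec p"
      using assms(2) v by auto
    have "(A * M * transpose_mat A) *\<^sub>v v = A *\<^sub>v (M *\<^sub>v ?w)"
      using assms(2) M v w by (simp add: assoc_mult_mat_vec[of _ p p _ p])
    then have "v \<bullet> ((A * M * transpose_mat A) *\<^sub>v v) = ?w \<bullet> (M *\<^sub>v ?w)"
      using transpose_vec_mult_scalar[OF assms(2), of "M *\<^sub>v ?w" v] M v w by simp
    then show ?thesis
      using assms(1) w by (simp add: psd_def)
  qed
  then show ?thesis
    using M assms(2) transpose_sandwich[OF assms(2) M] by (simp add: psd_def)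
qed

text \<open>By cyclicity of the trace, conjugating \<open>Q\<close> by \<open>A\<close> amounts to
  conjugating the test matrix by the transpose of \<open>A\<close>, which keeps it positive
  semidefinite.\<close>

lemma trace_pos_sandwich:
  assumes "trace_pos p Q" "A \<in> carrier_mat p p"
  shows "trace_pos p (A * Q * transpose_mat A)"
proof -
  have Q: "Q \<in> carrier_mat p p" "transpose_mat Q = Q"
    using assms(1) by (auto simp: trace_pos_def)
  have "0 \<le> mat_trace (A * Q * transpose_mat A * M)" if M: "psd p M" for M
  proof -
    have Mc: "M \<in> carrier_mat p p"
      using M by (simp add: psd_def)
    have "A * Q * transpose_mat A * M = A * (Q * (transpose_mat A * M))"
      using assms(2) Q Mc by (simp add: assoc_mult_mat[of _ p p _ p _ p])
    then have "mat_trace (A * Q * transpose_mat A * M) = mat_trace ((Q * (transpose_mat A * M)) * A)"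
      using assms(2) Q Mc by (simp add: mat_trace_comm[of A p])
    also have "(Q * (transpose_mat A * M)) * A = Q * (transpose_mat A * M * transpose_mat (transpose_mat A))"
      using assms(2) Q Mc by (simp add: assoc_mult_mat[of _ p p _ p _ p])
    finally show ?thesis
      using assms(1) psd_sandwich[OF M, of "transpose_mat A"] assms(2) by (simp add: trace_pos_def)
  qed
  then show ?thesis
    using Q assms(2) transpose_sandwich[OF assms(2) Q] by (simp add: trace_pos_def)
qed

text \<open>Twice the difference of the two sides is tr(S D S D') for D = M - M', which is
  nonnegative because D S D' is positive semidefinite. It absorbs the term of the variance in which
  \<open>M\<close> is not transposed.\<close>

lemma mat_trace_mult4_le:
  assumes "trace_pos p S" "psd p S" "M \<in> carrier_mat p p"
  shows "mat_trace (S * M * S * M) \<le> mat_trace (S * M * S * transpose_mat M)"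
proof -
  let ?T = "transpose_mat M"
  have S: "S \<in> carrier_mat p p" "transpose_mat S = S" and T: "?T \<in> carrier_mat p p"
    using assms by (auto simp: trace_pos_def)
  note a = assoc_mult_mat[of _ p p _ p _ p] and c = mult_carrier_mat[of _ p p _ p] minus_carrier_mat
  have "psd p ((M - ?T) * S * transpose_mat (M - ?T))"
    using assms(3) by (intro psd_sandwich[OF assms(2)]) auto
  then have "0 \<le> mat_trace (S * ((M - ?T) * S * transpose_mat (M - ?T)))"
    using assms(1) unfolding trace_pos_def by blast
  also have "transpose_mat (M - ?T) = ?T - M"
    using assms(3) by (auto simp: transpose_minus)
  also have "S * ((M - ?T) * S * (?T - M)) = (S * M * S * ?T - S * ?T * S * ?T) - (S * M * S * M - S * ?T * S * M)"
    using S T assms(3)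
    by (simp add: a minus_mult_distrib_mat[of _ p p _ _ p] mult_minus_distrib_mat[of _ p p _ p]
        c)
  also have "mat_trace \<dots> = (mat_trace (S * M * S * ?T) - mat_trace (S * ?T * S * ?T))
      - (mat_trace (S * M * S * M) - mat_trace (S * ?T * S * M))"
    using S T assms(3) by (simp add: mat_trace_diff[of _ p] c)
  also have "mat_trace (S * ?T * S * ?T) = mat_trace (S * M * S * M)"
  proof -
    have "mat_trace (S * M * S * M) = mat_trace (transpose_mat (S * M * S * M))"
      using S assms(3) by (simp add: mat_trace_transpose[of _ p] c)
    also have "transpose_mat (S * M * S * M) = ?T * (S * ?T * S)"
      using S T assms(3) by (simp add: transpose_mult[of _ p p _ p] a c)
    also have "mat_trace \<dots> = mat_trace (S * ?T * S * ?T)"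
      using S T by (simp add: mat_trace_comm[of ?T p] c)
    finally show ?thesis by simp
  qed
  also have "mat_trace (S * ?T * S * M) = mat_trace (S * M * S * ?T)"
  proof -
    have "mat_trace (S * ?T * S * M) = mat_trace ((S * ?T) * (S * M))"
      using S T assms(3) by (simp add: a c)
    also have "\<dots> = mat_trace ((S * M) * (S * ?T))"
      using S T assms(3) by (intro mat_trace_comm[of _ p]) (auto simp: c)
    finally show ?thesis 
      using S T assms(3) by (simp add: a c)
  qed
  finally show ?thesis by simp
qed

section \<open>Second moments of traces of products of independent random matrices\<close>

text \<open>Measurability is asked entrywise, which avoids a sigma-algebra on matrices of varying
  dimension. The carrier condition holds at every point, so matrix algebra meets no exceptional null
  sets.\<close>

definition rmat :: "nat \<Rightarrow> 'a measure \<Rightarrow> ('a \<Rightarrow> real mat) \<Rightarrow> bool" where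
  "rmat p F A \<longleftrightarrow> (\<forall>x. A x \<in> carrier_mat p p) \<and>
     (\<forall>a<p. \<forall>b<p. (\<lambda>x. A x $$ (a, b)) \<in> borel_measurable F)"

lemma rmat_const: "B \<in> carrier_mat p p \<Longrightarrow> rmat p F (\<lambda>_. B)"
  by (auto simp: rmat_def)

lemma rmat_mult:
  assumes "rmat p F A" "rmat p F B"
  shows "rmat p F (\<lambda>x. A x * B x)"
proof -
  have "(\<lambda>x. (A x * B x) $$ (a, b)) \<in> borel_measurable F" if "a < p" "b < p" for a b
  proof -
    have "(\<lambda>x. (A x * B x) $$ (a, b)) = (\<lambda>x. \<Sum>k<p. A x $$ (a, k) * B x $$ (k, b))"
      using assms that by (auto simp: rmat_def mult_entry[of _ p] simp del: index_mult_mat(1))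
    also have "\<dots> \<in> borel_measurable F"
      using assms that by (intro borel_measurable_sum borel_measurable_times) (auto simp: rmat_def)
    finally show ?thesis .
  qed
  then show ?thesis
    using assms by (auto simp: rmat_def simp del: index_mult_mat(1) intro: mult_carrier_mat[of _ p p _ p])
qed

lemma rmat_diff:
  assumes "rmat p F A" "rmat p F B"
  shows "rmat p F (\<lambda>x. A x - B x)"
proof -
  have d: "dim_row (B x) = p" "dim_col (B x) = p" for x
    using assms by (auto simp: rmat_def dest: carrier_matD)
  show ?thesis
    using assms by (auto simp: rmat_def minus_carrier_mat d intro!: borel_measurable_diff)
qed

lemma rmat_transpose:
  assumes "rmat p F A"
  shows "rmat p F (\<lambda>x. transpose_mat (A x))"
proof -
  have d: "dim_row (A x) = p" "dim_col (A x) = p" for x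
    using assms by (auto simp: rmat_def dest: carrier_matD)
  show ?thesis
    using assms by (auto simp: rmat_def d)
qed

lemma rmat_compose: "f \<in> measurable G F \<Longrightarrow> rmat p F A \<Longrightarrow> rmat p G (\<lambda>x. A (f x))"
  by (auto simp: rmat_def intro: measurable_compose)

lemma rmat_trace:
  assumes "rmat p F A"
  shows "(\<lambda>x. mat_trace (A x)) \<in> borel_measurable F"
proof -
  have "(\<lambda>x. mat_trace (A x)) = (\<lambda>x. \<Sum>i<p. A x $$ (i, i))"
    using assms by (auto simp: rmat_def mat_trace_def fun_eq_iff dest!: spec carrier_matD(1))
  also have "\<dots> \<in> borel_measurable F"
    using assms by (intro borel_measurable_sum) (auto simp: rmat_def)
  finally show ?thesis .
qed

lemma sum_quad_product:
  fixes f g :: "nat \<Rightarrow> nat \<Rightarrow> real"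
  shows "(\<Sum>(a, b, c, d)\<in>{..<p} \<times> {..<p} \<times> {..<p} \<times> {..<p}. f a b * g c d) =
    (\<Sum>a<p. \<Sum>b<p. f a b) * (\<Sum>c<p. \<Sum>d<p. g c d)"
  by (simp add: sum.cartesian_product[symmetric] sum_distrib_left[symmetric] sum_distrib_right[symmetric])

text \<open>Two sub-sigma-algebras are independent if and only if the identity maps into them are independent.\<close>

lemma (in prob_space) nn_integral_decouple:
  assumes ind: "indep_var F (\<lambda>x. x) G (\<lambda>x. x)" and f: "f \<in> borel_measurable (F \<Otimes>\<^sub>M G)"
  shows "(\<integral>\<^sup>+x. f (x, x) \<partial>M) = (\<integral>\<^sup>+y. (\<integral>\<^sup>+x. f (x, y) \<partial>M) \<partial>M)"
proof -
  note rv = indep_var_rv1[OF ind] indep_var_rv2[OF ind]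
  interpret X: prob_space "distr M F (\<lambda>x. x)" by (rule prob_space_distr) fact
  interpret Y: prob_space "distr M G (\<lambda>x. x)" by (rule prob_space_distr) fact
  interpret XY: pair_prob_space "distr M F (\<lambda>x. x)" "distr M G (\<lambda>x. x)" ..
  have f': "f \<in> borel_measurable (distr M F (\<lambda>x. x) \<Otimes>\<^sub>M distr M G (\<lambda>x. x))"
    using f by (simp cong: measurable_cong_sets)
  have "(\<integral>\<^sup>+x. f (x, x) \<partial>M) = (\<integral>\<^sup>+z. f z \<partial>distr M (F \<Otimes>\<^sub>M G) (\<lambda>x. (x, x)))"
    using rv f by (subst nn_integral_distr) auto
  \<comment> \<open>Independence enters here: the diagonal map carries \<open>M\<close> to the
    product of its restrictions to \<open>F\<close> and \<open>G\<close>.\<close>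
  also have "\<dots> = (\<integral>\<^sup>+z. f z \<partial>(distr M F (\<lambda>x. x) \<Otimes>\<^sub>M distr M G (\<lambda>x. x)))"
    using ind by (simp add: indep_var_distribution_eq)
  also have "\<dots> = (\<integral>\<^sup>+y. (\<integral>\<^sup>+x. f (x, y) \<partial>distr M F (\<lambda>x. x)) \<partial>distr M G (\<lambda>x. x))"
    using XY.nn_integral_snd[of "\<lambda>z. f z"] f' by simp
  also have "\<dots> = (\<integral>\<^sup>+y. (\<integral>\<^sup>+x. f (x, y) \<partial>distr M F (\<lambda>x. x)) \<partial>M)"
    using f' rv by (subst nn_integral_distr) (auto intro!: X.borel_measurable_nn_integral simp: split_def cong: measurable_cong_sets)
  also have "\<dots> = (\<integral>\<^sup>+y. (\<integral>\<^sup>+x. f (x, y) \<partial>M) \<partial>M)"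
  proof (rule nn_integral_cong)
    fix y assume "y \<in> space M"
    then have y: "y \<in> space G" using rv(2) by (auto dest: measurable_space)
    show "(\<integral>\<^sup>+x. f (x, y) \<partial>distr M F (\<lambda>x. x)) = (\<integral>\<^sup>+x. f (x, y) \<partial>M)"
      using rv y f by (subst nn_integral_distr) auto
  qed
  finally show ?thesis .
qed

text \<open>The mean and the covariances of the entries of W/k, where W has the Wishart distribution with scale S and k = 1/\<kappa> degrees of freedom.\<close>

definition (in prob_space) wishart_moments :: "nat \<Rightarrow> real mat \<Rightarrow> real \<Rightarrow> ('a \<Rightarrow> real mat) \<Rightarrow> bool" where
  "wishart_moments p S \<kappa> A \<longleftrightarrow> S \<in> carrier_mat p p \<and> transpose_mat S = S \<and>
     (\<forall>x. A x \<in> carrier_mat p p \<and> transpose_mat (A x) = A x) \<and>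
     (\<forall>a<p. \<forall>b<p. has_bochner_integral M (\<lambda>x. A x $$ (a, b)) (S $$ (a, b))) \<and>
     (\<forall>a<p. \<forall>b<p. \<forall>c<p. \<forall>d<p. has_bochner_integral M (\<lambda>x. A x $$ (a, b) * A x $$ (c, d))
        (S $$ (a, b) * S $$ (c, d) + \<kappa> * (S $$ (a, c) * S $$ (b, d) + S $$ (a, d) * S $$ (b, c))))"

lemma mat_symD:
  assumes "transpose_mat A = A" "A \<in> carrier_mat p p" "i < p" "j < p"
  shows "A $$ (i, j) = A $$ (j, i)"
  by (metis assms carrier_matD index_transpose_mat(1))

text \<open>The second moment of two entries has three terms. The product of means gives tr(Q S N
  S); one covariance term gives the same trace again, after exchanging two indices by the symmetry
  of \<open>N\<close>; the other one decouples into a product of traces.\<close>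

lemma (in prob_space) wishart_moments_sandwich:
  assumes B: "wishart_moments p S \<kappa> B" and Q: "Q \<in> carrier_mat p p"
    and N: "N \<in> carrier_mat p p" "transpose_mat N = N"
  shows "has_bochner_integral M (\<lambda>x. mat_trace (Q * B x * N * B x))
    ((1 + \<kappa>) * mat_trace (Q * S * N * S) + \<kappa> * mat_trace (Q * S) * mat_trace (S * N))"
proof -
  let ?I = "{..<p} \<times> {..<p} \<times> {..<p} \<times> {..<p}"
  have S: "S \<in> carrier_mat p p" "transpose_mat S = S" and Bc: "\<And>x. B x \<in> carrier_mat p p"
    using B by (auto simp: wishart_moments_def)
  note sS = mat_symD[OF S(2,1)] and sN = mat_symD[OF N(2,1)]
  have "has_bochner_integral M (\<lambda>x. \<Sum>(a, b, c, d)\<in>?I. (Q $$ (a, b) * N $$ (c, d)) * (B x $$ (b, c) * B x $$ (d, a)))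
    (\<Sum>(a, b, c, d)\<in>?I. (Q $$ (a, b) * N $$ (c, d)) * (S $$ (b, c) * S $$ (d, a)
       + \<kappa> * (S $$ (b, d) * S $$ (c, a) + S $$ (b, a) * S $$ (c, d))))"
    unfolding split_def using B
    by (intro has_bochner_integral_sum has_bochner_integral_mult_right) (auto simp: wishart_moments_def)
  also have "(\<lambda>x. \<Sum>(a, b, c, d)\<in>?I. (Q $$ (a, b) * N $$ (c, d)) * (B x $$ (b, c) * B x $$ (d, a)))
      = (\<lambda>x. mat_trace (Q * B x * N * B x))"
    using Q N Bc by (simp add: mat_trace_mult4[of _ p] mult_ac)
  also have "(\<Sum>(a, b, c, d)\<in>?I. (Q $$ (a, b) * N $$ (c, d)) * (S $$ (b, c) * S $$ (d, a)
       + \<kappa> * (S $$ (b, d) * S $$ (c, a) + S $$ (b, a) * S $$ (c, d))))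
    = (\<Sum>(a, b, c, d)\<in>?I. Q $$ (a, b) * S $$ (b, c) * N $$ (c, d) * S $$ (d, a))
      + \<kappa> * (\<Sum>(a, b, c, d)\<in>?I. Q $$ (a, b) * N $$ (c, d) * S $$ (b, d) * S $$ (c, a))
      + \<kappa> * (\<Sum>(a, b, c, d)\<in>?I. (Q $$ (a, b) * S $$ (b, a)) * (N $$ (c, d) * S $$ (c, d)))"
    by (simp add: sum_distrib_left sum.distrib[symmetric] split_def algebra_simps)
  also have "(\<Sum>(a, b, c, d)\<in>?I. Q $$ (a, b) * N $$ (c, d) * S $$ (b, d) * S $$ (c, a))
      = (\<Sum>(a, b, c, d)\<in>?I. Q $$ (a, b) * S $$ (b, c) * N $$ (c, d) * S $$ (d, a))"
    by (rule sum.reindex_bij_witness[where i = "\<lambda>(a, b, c, d). (a, b, d, c)" and j = "\<lambda>(a, b, c, d). (a, b, d, c)"])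
      (auto simp: sN)
  also have "(\<Sum>(a, b, c, d)\<in>?I. (Q $$ (a, b) * S $$ (b, a)) * (N $$ (c, d) * S $$ (c, d)))
      = mat_trace (Q * S) * mat_trace (S * N)"
  proof -
    have "mat_trace (S * N) = (\<Sum>c<p. \<Sum>d<p. N $$ (c, d) * S $$ (c, d))"
      unfolding mat_trace_mult[OF S(1) N(1)] by (intro sum.cong refl) (auto simp: sN)
    then show ?thesis
      unfolding mat_trace_mult[OF Q S(1)]
      by (simp add: sum_quad_product[of "\<lambda>a b. Q $$ (a, b) * S $$ (b, a)" "\<lambda>c d. N $$ (c, d) * S $$ (c, d)"])
  qed
  finally show ?thesis
    unfolding mat_trace_mult4[OF Q S(1) N(1) S(1)] by (simp add: ring_distribs add_ac mult.assoc)
qed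

text \<open>Centering leaves the covariance terms only. They differ in the order in which
  \<open>N\<close> is traversed the second time, hence one trace with the transpose of
  \<open>N\<close> and one without.\<close>

lemma (in prob_space) wishart_moments_variance:
  assumes A: "wishart_moments p S \<kappa> A" and N: "N \<in> carrier_mat p p"
  shows "has_bochner_integral M (\<lambda>x. (mat_trace ((A x - S) * N))\<^sup>2)
    (\<kappa> * (mat_trace (S * N * S * transpose_mat N) + mat_trace (S * N * S * N)))"
proof -
  let ?I = "{..<p} \<times> {..<p} \<times> {..<p} \<times> {..<p}"
  have S: "S \<in> carrier_mat p p" "transpose_mat S = S" and Ac: "\<And>x. A x \<in> carrier_mat p p"
    using A by (auto simp: wishart_moments_def)
  note sS = mat_symD[OF S(2,1)]
  have cov: "has_bochner_integral M (\<lambda>x. (A x $$ (a, b) - S $$ (a, b)) * (A x $$ (c, d) - S $$ (c, d)))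
      (\<kappa> * (S $$ (a, c) * S $$ (b, d) + S $$ (a, d) * S $$ (b, c)))"
    if "a < p" "b < p" "c < p" "d < p" for a b c d
  proof -
    have 1: "has_bochner_integral M (\<lambda>x. A x $$ (a, b) * A x $$ (c, d))
        (S $$ (a, b) * S $$ (c, d) + \<kappa> * (S $$ (a, c) * S $$ (b, d) + S $$ (a, d) * S $$ (b, c)))"
      "has_bochner_integral M (\<lambda>x. A x $$ (a, b)) (S $$ (a, b))"
      "has_bochner_integral M (\<lambda>x. A x $$ (c, d)) (S $$ (c, d))"
      using A that by (auto simp: wishart_moments_def)
    have 2: "has_bochner_integral M (\<lambda>x. S $$ (a, b) * S $$ (c, d)) (S $$ (a, b) * S $$ (c, d))"
      by (simp add: has_bochner_integral_iff prob_space)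
    have "has_bochner_integral M (\<lambda>x. A x $$ (a, b) * A x $$ (c, d) - S $$ (c, d) * A x $$ (a, b)
        - S $$ (a, b) * A x $$ (c, d) + S $$ (a, b) * S $$ (c, d))
      (S $$ (a, b) * S $$ (c, d) + \<kappa> * (S $$ (a, c) * S $$ (b, d) + S $$ (a, d) * S $$ (b, c))
        - S $$ (c, d) * S $$ (a, b) - S $$ (a, b) * S $$ (c, d) + S $$ (a, b) * S $$ (c, d))"
      by (intro has_bochner_integral_add has_bochner_integral_diff has_bochner_integral_mult_right 1 2)
    then show ?thesis
      by (simp add: algebra_simps)
  qed
  have "has_bochner_integral M (\<lambda>x. \<Sum>(a, b, c, d)\<in>?I. (N $$ (b, a) * N $$ (d, c))
        * ((A x $$ (a, b) - S $$ (a, b)) * (A x $$ (c, d) - S $$ (c, d))))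
    (\<Sum>(a, b, c, d)\<in>?I. (N $$ (b, a) * N $$ (d, c)) * (\<kappa> * (S $$ (a, c) * S $$ (b, d) + S $$ (a, d) * S $$ (b, c))))"
    unfolding split_def by (intro has_bochner_integral_sum has_bochner_integral_mult_right) (auto intro: cov)
  also have "(\<lambda>x. \<Sum>(a, b, c, d)\<in>?I. (N $$ (b, a) * N $$ (d, c))
        * ((A x $$ (a, b) - S $$ (a, b)) * (A x $$ (c, d) - S $$ (c, d))))
    = (\<lambda>x. (mat_trace ((A x - S) * N))\<^sup>2)"
  proof
    fix x
    let ?f = "\<lambda>a b. (A x $$ (a, b) - S $$ (a, b)) * N $$ (b, a)"
    have "mat_trace ((A x - S) * N) = (\<Sum>a<p. \<Sum>b<p. ?f a b)"
      using Ac[of x] S N by (subst mat_trace_mult[of _ p]) (auto simp: minus_carrier_mat)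
    then show "(\<Sum>(a, b, c, d)\<in>?I. (N $$ (b, a) * N $$ (d, c))
        * ((A x $$ (a, b) - S $$ (a, b)) * (A x $$ (c, d) - S $$ (c, d)))) = (mat_trace ((A x - S) * N))\<^sup>2"
      using sum_quad_product[of ?f ?f p] by (simp add: power2_eq_square mult_ac)
  qed
  also have "(\<Sum>(a, b, c, d)\<in>?I. (N $$ (b, a) * N $$ (d, c)) * (\<kappa> * (S $$ (a, c) * S $$ (b, d) + S $$ (a, d) * S $$ (b, c))))
    = \<kappa> * ((\<Sum>(a, b, c, d)\<in>?I. N $$ (b, a) * N $$ (d, c) * S $$ (a, c) * S $$ (b, d))
      + (\<Sum>(a, b, c, d)\<in>?I. N $$ (b, a) * N $$ (d, c) * S $$ (a, d) * S $$ (b, c)))"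
    by (simp add: sum_distrib_left sum.distrib[symmetric] split_def algebra_simps)
  also have "(\<Sum>(a, b, c, d)\<in>?I. N $$ (b, a) * N $$ (d, c) * S $$ (a, c) * S $$ (b, d))
     = mat_trace (S * N * S * transpose_mat N)"
    unfolding mat_trace_mult4[OF S(1) N S(1) transpose_carrier_mat[THEN iffD2, OF N]]
    by (rule sum.reindex_bij_witness[where i = "\<lambda>(b, d, c, a). (a, b, c, d)" and j = "\<lambda>(a, b, c, d). (b, d, c, a)"])
      (use N in \<open>auto simp: sS\<close>)
  also have "(\<Sum>(a, b, c, d)\<in>?I. N $$ (b, a) * N $$ (d, c) * S $$ (a, d) * S $$ (b, c))
     = mat_trace (S * N * S * N)"
    unfolding mat_trace_mult4[OF S(1) N S(1) N]
    by (rule sum.reindex_bij_witness[where i = "\<lambda>(a, d, c, b). (a, b, c, d)" and j = "\<lambda>(a, b, c, d). (a, d, c, b)"])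
      (auto simp: sS)
  finally show ?thesis by simp
qed

section \<open>Integrating out one random factor\<close>

lemma trace_posD:
  "trace_pos p Q \<Longrightarrow> Q \<in> carrier_mat p p" "trace_pos p Q \<Longrightarrow> transpose_mat Q = Q"
  "trace_pos p Q \<Longrightarrow> psd p M \<Longrightarrow> 0 \<le> mat_trace (Q * M)"
  by (auto simp: trace_pos_def)

lemma (in prob_space) indep_id_measurable:
  assumes "indep_var F (\<lambda>x. x) G (\<lambda>x. x)"
  shows "(\<lambda>x. x) \<in> measurable M F" "(\<lambda>x. x) \<in> measurable M G"
  using indep_var_rv1[OF assms] indep_var_rv2[OF assms] by auto

text \<open>Independence allows \<open>N\<close> to be frozen while
  \<open>wishart_moments_sandwich\<close> averages over \<open>B\<close>. On the right
  \<open>N\<close> is again paired with fixed matrices of the dual cone, \<open>S * Q * S\<close>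
  and \<open>S\<close>, so the estimate can be iterated.\<close>

lemma (in prob_space) nn_integral_sandwich_le:
  assumes B: "wishart_moments p S \<kappa> B" "rmat p F B" and \<kappa>: "0 \<le> \<kappa>" "\<kappa> \<le> \<kappa>'" "\<kappa>' \<le> 1"
    and S: "trace_pos p S" "psd p S" and Q: "trace_pos p Q"
    and N: "rmat p G N" "\<And>x. psd p (N x)"
    and ind: "indep_var F (\<lambda>x. x) G (\<lambda>x. x)"
  shows "(\<integral>\<^sup>+x. ennreal (mat_trace (Q * (B x * N x * B x))) \<partial>M) \<le>
    2 * (\<integral>\<^sup>+x. ennreal (mat_trace (S * Q * S * N x)) \<partial>M)
    + ennreal (\<kappa>' * mat_trace (Q * S)) * (\<integral>\<^sup>+x. ennreal (mat_trace (S * N x)) \<partial>M)"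
proof -
  note a = assoc_mult_mat[of _ p p _ p _ p] and c = mult_carrier_mat[of _ p p _ p] minus_carrier_mat
  have Sc: "S \<in> carrier_mat p p" "transpose_mat S = S" and Qc: "Q \<in> carrier_mat p p"
    and Nc: "\<And>x. N x \<in> carrier_mat p p" "\<And>x. transpose_mat (N x) = N x"
    and Bc: "\<And>x. B x \<in> carrier_mat p p" "\<And>x. transpose_mat (B x) = B x"
    using S Q N(2) B(1) by (auto simp: trace_pos_def psd_def wishart_moments_def)
  have SQS: "trace_pos p (S * Q * S)"
    using trace_pos_sandwich[OF Q Sc(1)] Sc by simp
  have meas [measurable]: "(\<lambda>x. mat_trace (K * N x)) \<in> borel_measurable M" if "K \<in> carrier_mat p p" for K
    using rmat_trace[OF rmat_mult[OF rmat_const[OF that] N(1)]] indep_id_measurable(2)[OF ind]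
    by (rule measurable_compose[rotated])
  have QS: "0 \<le> mat_trace (Q * S)"
    using trace_posD(3)[OF Q S(2)] .
  have inner: "(\<integral>\<^sup>+x. ennreal (mat_trace (Q * (B x * N y * B x))) \<partial>M) \<le>
      2 * ennreal (mat_trace (S * Q * S * N y)) + ennreal (\<kappa>' * mat_trace (Q * S)) * ennreal (mat_trace (S * N y))" for y
  proof -
    have nn: "0 \<le> mat_trace (S * Q * S * N y)" "0 \<le> mat_trace (S * N y)"
      using trace_posD(3)[OF SQS N(2)] trace_posD(3)[OF S(1) N(2)] by auto
    have "Q * (B x * N y * B x) = Q * B x * N y * B x" for x
      using Qc Bc Nc by (simp add: a c)
    then have int: "has_bochner_integral M (\<lambda>x. mat_trace (Q * (B x * N y * B x)))
        ((1 + \<kappa>) * mat_trace (Q * S * N y * S) + \<kappa> * mat_trace (Q * S) * mat_trace (S * N y))"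
      using wishart_moments_sandwich[OF B(1) Qc Nc] by simp
    have eq: "mat_trace (Q * S * N y * S) = mat_trace (S * Q * S * N y)"
    proof -
      have "mat_trace (Q * S * N y * S) = mat_trace (S * (Q * S * N y))"
        using Sc Qc Nc by (intro mat_trace_comm[of _ p]) (auto simp: c)
      then show ?thesis
        using Sc Qc Nc by (simp add: a c)
    qed
    have "0 \<le> mat_trace (Q * (B x * N y * B x))" for x
      using trace_posD(3)[OF Q psd_sandwich[OF N(2) Bc(1)]] Bc by simp
    then have "(\<integral>\<^sup>+x. ennreal (mat_trace (Q * (B x * N y * B x))) \<partial>M) =
        ennreal ((1 + \<kappa>) * mat_trace (S * Q * S * N y) + \<kappa> * mat_trace (Q * S) * mat_trace (S * N y))"
      using int unfolding eq by (subst nn_integral_eq_integral) (auto simp: has_bochner_integral_iff)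
    also have "\<dots> \<le> ennreal (2 * mat_trace (S * Q * S * N y) + \<kappa>' * mat_trace (Q * S) * mat_trace (S * N y))"
      using \<kappa> nn QS by (intro ennreal_leI add_mono mult_right_mono) auto
    also have "\<dots> = 2 * ennreal (mat_trace (S * Q * S * N y)) + ennreal (\<kappa>' * mat_trace (Q * S)) * ennreal (mat_trace (S * N y))"
      using \<kappa> nn QS by (simp add: ennreal_mult'[symmetric] ennreal_plus[symmetric] del: ennreal_plus flip: ennreal_numeral)
    finally show ?thesis .
  qed
  have f: "(\<lambda>z. ennreal (mat_trace (Q * (B (fst z) * N (snd z) * B (fst z))))) \<in> borel_measurable (F \<Otimes>\<^sub>M G)"
    by (intro measurable_compose[OF _ measurable_ennreal] rmat_trace[of p] rmat_mult rmat_const Qc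
        rmat_compose[OF measurable_fst B(2)] rmat_compose[OF measurable_snd N(1)])
  have "(\<integral>\<^sup>+x. ennreal (mat_trace (Q * (B x * N x * B x))) \<partial>M)
      = (\<integral>\<^sup>+y. (\<integral>\<^sup>+x. ennreal (mat_trace (Q * (B x * N y * B x))) \<partial>M) \<partial>M)"
    using nn_integral_decouple[OF ind f] by simp
  also have "\<dots> \<le> (\<integral>\<^sup>+y. 2 * ennreal (mat_trace (S * Q * S * N y))
      + ennreal (\<kappa>' * mat_trace (Q * S)) * ennreal (mat_trace (S * N y)) \<partial>M)"
    by (intro nn_integral_mono inner)
  also have "\<dots> = 2 * (\<integral>\<^sup>+x. ennreal (mat_trace (S * Q * S * N x)) \<partial>M)
    + ennreal (\<kappa>' * mat_trace (Q * S)) * (\<integral>\<^sup>+x. ennreal (mat_trace (S * N x)) \<partial>M)"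
    using meas[OF trace_posD(1)[OF SQS]] meas[OF Sc(1)]
    by (simp add: nn_integral_add nn_integral_cmult)
  finally show ?thesis .
qed

text \<open>With \<open>N\<close> frozen this is the variance formula, whose second trace is at most
  the first by \<open>mat_trace_mult4_le\<close>; hence the 2. The trace that is kept has a positive
  semidefinite sandwich inside, as the recursion requires.\<close>

lemma (in prob_space) nn_integral_deviation_le:
  assumes A: "wishart_moments p S \<kappa> A" "rmat p F A" and \<kappa>: "0 \<le> \<kappa>" "\<kappa> \<le> \<kappa>'"
    and S: "trace_pos p S" "psd p S" and N: "rmat p G N"
    and ind: "indep_var F (\<lambda>x. x) G (\<lambda>x. x)"
  shows "(\<integral>\<^sup>+x. ennreal ((mat_trace ((A x - S) * N x))\<^sup>2) \<partial>M) \<le>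
    ennreal (2 * \<kappa>') * (\<integral>\<^sup>+x. ennreal (mat_trace (S * (N x * S * transpose_mat (N x)))) \<partial>M)"
proof -
  note a = assoc_mult_mat[of _ p p _ p _ p] and c = mult_carrier_mat[of _ p p _ p] minus_carrier_mat
  have Sc: "S \<in> carrier_mat p p" and Nc: "\<And>x. N x \<in> carrier_mat p p"
    using S N by (auto simp: trace_pos_def rmat_def)
  have meas: "(\<lambda>x. ennreal (mat_trace (S * (N x * S * transpose_mat (N x))))) \<in> borel_measurable M"
  proof (rule measurable_compose[OF indep_id_measurable(2)[OF ind]])
    show "(\<lambda>x. ennreal (mat_trace (S * (N x * S * transpose_mat (N x))))) \<in> borel_measurable G"
      by (intro measurable_compose[OF _ measurable_ennreal] rmat_trace[of p] rmat_mult rmat_const rmat_transpose Sc N)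
  qed
  have f: "(\<lambda>z. ennreal ((mat_trace ((A (fst z) - S) * N (snd z)))\<^sup>2)) \<in> borel_measurable (F \<Otimes>\<^sub>M G)"
    by (intro measurable_compose[OF _ measurable_ennreal] borel_measurable_power rmat_trace[of p] rmat_mult rmat_diff rmat_const Sc
        rmat_compose[OF measurable_fst A(2)] rmat_compose[OF measurable_snd N(1)])
  have inner: "(\<integral>\<^sup>+x. ennreal ((mat_trace ((A x - S) * N y))\<^sup>2) \<partial>M) \<le>
     ennreal (2 * \<kappa>') * ennreal (mat_trace (S * (N y * S * transpose_mat (N y))))" for y
  proof -
    let ?t = "mat_trace (S * N y * S * transpose_mat (N y))"
    have eq: "S * (N y * S * transpose_mat (N y)) = S * N y * S * transpose_mat (N y)"
      using Sc Nc[of y] by (simp add: a c)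
    have t: "0 \<le> ?t"
      using trace_posD(3)[OF S(1) psd_sandwich[OF S(2) Nc[of y]]] unfolding eq .
    have "(\<integral>\<^sup>+x. ennreal ((mat_trace ((A x - S) * N y))\<^sup>2) \<partial>M) = ennreal (\<kappa> * (?t + mat_trace (S * N y * S * N y)))"
      using wishart_moments_variance[OF A(1) Nc[of y]]
      by (subst nn_integral_eq_integral) (auto simp: has_bochner_integral_iff)
    also have "\<dots> \<le> ennreal (\<kappa>' * (?t + ?t))"
      using \<kappa> t mat_trace_mult4_le[OF S Nc[of y]]
      by (intro ennreal_leI order_trans[OF mult_left_mono mult_right_mono[of \<kappa> \<kappa>']]) auto
    also have "\<dots> = ennreal (2 * \<kappa>') * ennreal ?t"
      using \<kappa> t by (simp add: ennreal_mult''[symmetric])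
    finally show ?thesis unfolding eq .
  qed
  have "(\<integral>\<^sup>+x. ennreal ((mat_trace ((A x - S) * N x))\<^sup>2) \<partial>M)
      = (\<integral>\<^sup>+y. (\<integral>\<^sup>+x. ennreal ((mat_trace ((A x - S) * N y))\<^sup>2) \<partial>M) \<partial>M)"
    using nn_integral_decouple[OF ind f] by simp
  also have "\<dots> \<le> (\<integral>\<^sup>+y. ennreal (2 * \<kappa>') * ennreal (mat_trace (S * (N y * S * transpose_mat (N y)))) \<partial>M)"
    by (intro nn_integral_mono inner)
  also have "\<dots> = ennreal (2 * \<kappa>') * (\<integral>\<^sup>+y. ennreal (mat_trace (S * (N y * S * transpose_mat (N y)))) \<partial>M)"
    using meas by (rule nn_integral_cmult)
  finally show ?thesis .
qed

text \<open>\<open>L\<close> bounds traces that are not divided by \<open>p\<close>. Words of length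
  8 arise when all factors in the square of a trace of four have been replaced by their means.
  \<open>F J\<close> is the information in the observations with index in \<open>J\<close>; the
  sampling scheme enters through independence of disjoint blocks and monotonicity.\<close>

locale wishart_words = prob_space M for M :: "'a measure" +
  fixes p :: nat and S :: "population \<Rightarrow> real mat" and \<kappa> L :: real
    and I :: "'j set" and F :: "'j set \<Rightarrow> 'a measure"
  assumes S: "trace_pos p (S i)" "psd p (S i)"
    and \<kappa>: "0 \<le> \<kappa>" "\<kappa> \<le> 1"
    and L: "2 \<le> length w \<Longrightarrow> length w \<le> 8 \<Longrightarrow> mat_trace (word_prod p (S PX) (S PY) w) \<le> L"
    and L_nonneg: "0 \<le> L"
    and F_indep: "J \<subseteq> I \<Longrightarrow> K \<subseteq> I \<Longrightarrow> J \<inter> K = {} \<Longrightarrow> indep_var (F J) (\<lambda>x. x) (F K) (\<lambda>x. x)"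
    and F_mono: "J \<subseteq> K \<Longrightarrow> K \<subseteq> I \<Longrightarrow> (\<lambda>x. x) \<in> measurable (F K) (F J)"
begin

abbreviation wp :: "population list \<Rightarrow> real mat" where
  "wp w \<equiv> word_prod p (S PX) (S PY) w"

lemma S_carrier [simp]: "S i \<in> carrier_mat p p" and S_sym [simp]: "transpose_mat (S i) = S i"
  using trace_posD[OF S(1)] by auto

lemma wp_Cons: "wp (i # w) = S i * wp w"
  by (cases i) auto

lemma wp_carrier [simp]: "wp w \<in> carrier_mat p p"
  by (induction w) (auto simp: wp_Cons intro: mult_carrier_mat[of _ p p _ p])

lemma wp_append: "wp (u @ w) = wp u * wp w"
  by (induction u) (auto simp: wp_Cons left_mult_one_mat[of _ p p] assoc_mult_mat[of _ p p _ p _ p])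

lemma wp_single [simp]: "wp [i] = S i"
  by (simp add: wp_Cons right_mult_one_mat[of _ p p])

lemma wp_rev: "transpose_mat (wp w) = wp (rev w)"
  by (induction w) (auto simp: wp_Cons transpose_mult[of _ p p _ p] wp_append right_mult_one_mat[of _ p p])

lemma psd_palindrome: "psd p (wp (u @ [i] @ rev u))"
  using psd_sandwich[OF S(2)[of i] wp_carrier[of u]]
  by (simp add: wp_append wp_rev wp_Cons assoc_mult_mat[of _ p p _ p _ p])

fun rprod :: "(population \<times> 'j set \<times> ('a \<Rightarrow> real mat)) list \<Rightarrow> 'a \<Rightarrow> real mat" where
  "rprod [] x = 1\<^sub>m p"
| "rprod ((i, J, A) # As) x = A x * rprod As x"

text \<open>Since the factors are symmetric, this is the product of the list, times
  \<open>N\<close>, times the transposed product. The recursion runs from the outside inwards, so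
  that the head can be integrated out against an independent middle.\<close>

fun sandwich :: "(population \<times> 'j set \<times> ('a \<Rightarrow> real mat)) list \<Rightarrow> real mat \<Rightarrow> 'a \<Rightarrow> real mat" where
  "sandwich [] N x = N"
| "sandwich ((i, J, A) # As) N x = A x * sandwich As N x * A x"

fun indices :: "(population \<times> 'j set \<times> ('a \<Rightarrow> real mat)) list \<Rightarrow> 'j set" where
  "indices [] = {}"
| "indices ((i, J, A) # As) = J \<union> indices As"

text \<open>The covariance parameter may vary below the common bound \<kappa>, because the same list
  may serve subsamples and whole samples, which have different degrees of freedom.\<close>

definition observed :: "population \<Rightarrow> 'j set \<Rightarrow> ('a \<Rightarrow> real mat) \<Rightarrow> bool" where
  "observed i J A \<longleftrightarrow> J \<subseteq> I \<and> rmat p (F J) A \<and> (\<exists>\<kappa>'. 0 \<le> \<kappa>' \<and> \<kappa>' \<le> \<kappa> \<and> wishart_moments p (S i) \<kappa>' A)"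

fun disjoint_observed :: "(population \<times> 'j set \<times> ('a \<Rightarrow> real mat)) list \<Rightarrow> bool" where
  "disjoint_observed [] \<longleftrightarrow> True"
| "disjoint_observed ((i, J, A) # As) \<longleftrightarrow> observed i J A \<and> J \<inter> indices As = {} \<and> disjoint_observed As"

lemma observed_carrier: "observed i J A \<Longrightarrow> A x \<in> carrier_mat p p" "observed i J A \<Longrightarrow> transpose_mat (A x) = A x"
  by (auto simp: observed_def wishart_moments_def)

lemma rmat_mono: "rmat p (F J) A \<Longrightarrow> J \<subseteq> K \<Longrightarrow> K \<subseteq> I \<Longrightarrow> rmat p (F K) A"
  using rmat_compose[OF F_mono] by blast

lemma indices_subset: "disjoint_observed As \<Longrightarrow> indices As \<subseteq> I"
  by (induction As) (auto simp: observed_def)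

lemma rmat_rprod: "disjoint_observed As \<Longrightarrow> rmat p (F (indices As)) (rprod As)"
proof (induction As)
  case Nil
  then show ?case by (simp add: rmat_const)
next
  case (Cons a As)
  obtain i J A where a: "a = (i, J, A)" by (cases a)
  have sub: "indices (a # As) \<subseteq> I"
    using indices_subset[OF Cons.prems] .
  have "rmat p (F (indices (a # As))) A" "rmat p (F (indices (a # As))) (rprod As)"
    using Cons sub by (auto simp: a observed_def intro: rmat_mono)
  then have "rmat p (F (indices (a # As))) (\<lambda>x. A x * rprod As x)"
    by (rule rmat_mult)
  then show ?case by (simp add: a)
qed

lemma rmat_sandwich:
  assumes "N \<in> carrier_mat p p"
  shows "disjoint_observed As \<Longrightarrow> rmat p (F (indices As)) (sandwich As N)"
proof (induction As)
  case Nil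
  then show ?case using assms by (simp add: rmat_const)
next
  case (Cons a As)
  obtain i J A where a: "a = (i, J, A)" by (cases a)
  have sub: "indices (a # As) \<subseteq> I"
    using indices_subset[OF Cons.prems] .
  have "rmat p (F (indices (a # As))) A" "rmat p (F (indices (a # As))) (sandwich As N)"
    using Cons sub by (auto simp: a observed_def intro: rmat_mono)
  then have "rmat p (F (indices (a # As))) (\<lambda>x. A x * sandwich As N x * A x)"
    by (intro rmat_mult)
  then show ?case by (simp add: a)
qed

lemma rprod_carrier: "disjoint_observed As \<Longrightarrow> rprod As x \<in> carrier_mat p p"
  using rmat_rprod by (auto simp: rmat_def)

lemma psd_sandwich_list: "psd p N \<Longrightarrow> disjoint_observed As \<Longrightarrow> psd p (sandwich As N x)"
proof (induction As)
  case (Cons a As)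
  obtain i J A where a: "a = (i, J, A)" by (cases a)
  show ?case
    using Cons psd_sandwich[of p "sandwich As N x" "A x"] observed_carrier[of i J A x] by (simp add: a)
qed simp

lemma sandwich_rprod:
  "N \<in> carrier_mat p p \<Longrightarrow> disjoint_observed As \<Longrightarrow>
    sandwich As N x = rprod As x * N * transpose_mat (rprod As x)"
proof (induction As)
  case (Cons a As)
  obtain i J A where a: "a = (i, J, A)" by (cases a)
  show ?case
    using Cons observed_carrier[of i J A x] rprod_carrier[of As x]
    by (simp add: a transpose_mult[of _ p p _ p] assoc_mult_mat[of _ p p _ p _ p] mult_carrier_mat[of _ p p _ p])
qed simp

text \<open>The cost of integrating out one random factor: 2 bounds 1 + \<kappa>, and \<kappa>
  \<open>L\<close> bounds the scalar trace that splits off in the other term.\<close>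

definition R :: real where "R = 2 + \<kappa> * L"

lemma R_ge_1: "1 \<le> R"
  using \<kappa> L_nonneg by (simp add: R_def)

text \<open>The word \<open>u\<close> is general because integrating out the head turns it into
  \<open>i # u @ [i]\<close> in one term and into \<open>[i]\<close> in the other. The length budget
  survives: \<open>u\<close> gains two letters when \<open>As\<close> loses an entry that counts
  twice.\<close>

lemma nn_integral_sandwich_list_le:
  assumes "psd p (wp v)" "1 \<le> length v"
  shows "disjoint_observed As \<Longrightarrow> trace_pos p (wp u) \<Longrightarrow> 1 \<le> length u \<Longrightarrow>
    length u + length v + 2 * length As \<le> 8 \<Longrightarrow>
    (\<integral>\<^sup>+x. ennreal (mat_trace (wp u * sandwich As (wp v) x)) \<partial>M) \<le> ennreal (L * R ^ length As)"
proof (induction As arbitrary: u)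
  case Nil
  then show ?case
    using assms(2) L[of "u @ v"] by (simp add: wp_append emeasure_space_1 ennreal_leI)
next
  case (Cons a As)
  obtain i J A where a: "a = (i, J, A)" by (cases a)
  have obs: "observed i J A" "J \<inter> indices As = {}" "disjoint_observed As" "J \<subseteq> I"
    using Cons.prems by (auto simp: a observed_def)
  obtain \<kappa>' where k': "0 \<le> \<kappa>'" "\<kappa>' \<le> \<kappa>" "wishart_moments p (S i) \<kappa>' A"
    using obs(1) by (auto simp: observed_def)
  let ?u = "i # u @ [i]"
  have pal: "wp ?u = S i * wp u * S i"
    by (simp add: wp_Cons wp_append right_mult_one_mat[of _ p p] assoc_mult_mat[of _ p p _ p _ p])
  have 1: "(\<integral>\<^sup>+x. ennreal (mat_trace (wp ?u * sandwich As (wp v) x)) \<partial>M) \<le> ennreal (L * R ^ length As)"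
    using Cons.prems obs trace_pos_sandwich[OF Cons.prems(2) S_carrier[of i]]
    by (intro Cons.IH) (auto simp: pal)
  have 2: "(\<integral>\<^sup>+x. ennreal (mat_trace (S i * sandwich As (wp v) x)) \<partial>M) \<le> ennreal (L * R ^ length As)"
    using Cons.IH[of "[i]"] Cons.prems obs S by simp
  have 3: "mat_trace (wp u * S i) \<le> L"
    using L[of "u @ [i]"] Cons.prems assms(2) by (simp add: wp_append)
  have "(\<integral>\<^sup>+x. ennreal (mat_trace (wp u * sandwich (a # As) (wp v) x)) \<partial>M) \<le>
     2 * (\<integral>\<^sup>+x. ennreal (mat_trace (wp ?u * sandwich As (wp v) x)) \<partial>M)
     + ennreal (\<kappa> * mat_trace (wp u * S i)) * (\<integral>\<^sup>+x. ennreal (mat_trace (S i * sandwich As (wp v) x)) \<partial>M)"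
    unfolding pal a sandwich.simps
    using obs k' \<kappa> S Cons.prems rmat_sandwich[of "wp v" As] psd_sandwich_list[OF assms(1)] indices_subset[of As]
    by (intro nn_integral_sandwich_le[where F = "F J" and G = "F (indices As)" and \<kappa> = \<kappa>'] F_indep)
      (auto simp: observed_def)
  also have "\<dots> \<le> 2 * ennreal (L * R ^ length As) + ennreal (\<kappa> * L) * ennreal (L * R ^ length As)"
    using 1 2 3 \<kappa> by (intro add_mono mult_mono ennreal_leI mult_left_mono) auto
  also have "\<dots> = ennreal (L * R ^ length (a # As))"
    using \<kappa> L_nonneg R_ge_1
    by (simp add: ennreal_mult'[symmetric] ennreal_plus[symmetric] R_def algebra_simps del: ennreal_plus flip: ennreal_numeral)
  finally show ?case .
qed

text \<open>
  The deviation is telescoped by replacing one random factor after the other by its mean.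
  By cyclicity the k-th replacement contributes the trace of the centred factor against the product of
  the remaining ones, whose second moment the previous lemma controls.
\<close>

lemma nn_integral_trace_deviation_le:
  "disjoint_observed As \<Longrightarrow> length u + length As \<le> 4 \<Longrightarrow> length As \<le> Suc q \<Longrightarrow>
    (\<integral>\<^sup>+x. ennreal ((mat_trace (wp u * rprod As x) - mat_trace (wp (u @ map fst As)))\<^sup>2) \<partial>M)
      \<le> ennreal (8 ^ length As * (\<kappa> * L * R ^ q))"
proof (induction As arbitrary: u)
  case Nil
  then show ?case by (simp add: right_mult_one_mat[of _ p p])
next
  case (Cons a As)
  obtain i J A where a: "a = (i, J, A)" by (cases a)
  have obs: "observed i J A" "J \<inter> indices As = {}" "disjoint_observed As" "J \<subseteq> I"
    using Cons.prems by (auto simp: a observed_def)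
  obtain \<kappa>' where k': "0 \<le> \<kappa>'" "\<kappa>' \<le> \<kappa>" "wishart_moments p (S i) \<kappa>' A"
    using obs(1) by (auto simp: observed_def)
  note as = assoc_mult_mat[of _ p p _ p _ p] and c = mult_carrier_mat[of _ p p _ p] minus_carrier_mat
  note carr = observed_carrier(1)[OF obs(1)] rprod_carrier[OF obs(3)]
  let ?N = "\<lambda>x. rprod As x * wp u"
  let ?D = "\<lambda>x. mat_trace ((A x - S i) * ?N x)"
  let ?E = "\<lambda>x. mat_trace (wp (u @ [i]) * rprod As x) - mat_trace (wp ((u @ [i]) @ map fst As))"
  have N: "rmat p (F (indices As)) ?N"
    by (intro rmat_mult rmat_rprod obs rmat_const wp_carrier)
  \<comment> \<open>The exponent \<open>q\<close> stays fixed through the induction, so that all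
    replacements share one bound; the tail has at most \<open>q\<close> factors and \<open>R\<close>
    is at least 1.\<close>
  have D: "(\<integral>\<^sup>+x. ennreal ((?D x)\<^sup>2) \<partial>M) \<le> ennreal (2 * (\<kappa> * L * R ^ q))"
  proof -
    \<comment> \<open>The fixed words on both sides close up to a palindrome around the letter
      \<open>i\<close>. As \<open>length u + length As \<le> 3\<close> here, the outer letter, the
      palindrome and the doubled tail together stay within length 8.\<close>
    have sand: "?N x * S i * transpose_mat (?N x) = sandwich As (wp (u @ [i] @ rev u)) x" for x
      using carr(2)[of x] obs(3)
      by (simp add: sandwich_rprod transpose_mult[of _ p p _ p] wp_append wp_rev wp_Cons as c)
    have "(\<integral>\<^sup>+x. ennreal ((?D x)\<^sup>2) \<partial>M) \<le>
      ennreal (2 * \<kappa>) * (\<integral>\<^sup>+x. ennreal (mat_trace (S i * (?N x * S i * transpose_mat (?N x)))) \<partial>M)"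
      using obs k' S N indices_subset[of As]
      by (intro nn_integral_deviation_le[where F = "F J" and G = "F (indices As)" and \<kappa> = \<kappa>'] F_indep)
        (auto simp: observed_def)
    also have "\<dots> \<le> ennreal (2 * \<kappa>) * ennreal (L * R ^ length As)"
      unfolding sand using nn_integral_sandwich_list_le[OF psd_palindrome[of u i], of As "[i]"] obs S Cons.prems
      by (intro mult_left_mono) auto
    also have "\<dots> \<le> ennreal (2 * \<kappa> * (L * R ^ q))"
      using \<kappa> L_nonneg R_ge_1 Cons.prems
      by (auto simp: ennreal_mult'[symmetric] intro!: ennreal_leI mult_left_mono power_increasing)
    finally show ?thesis by (simp add: mult_ac)
  qed
  have E: "(\<integral>\<^sup>+x. ennreal ((?E x)\<^sup>2) \<partial>M) \<le> ennreal (8 ^ length As * (\<kappa> * L * R ^ q))"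
    using Cons.prems obs by (intro Cons.IH) auto
  have split: "mat_trace (wp u * rprod (a # As) x) - mat_trace (wp (u @ map fst (a # As))) = ?D x + ?E x" for x
  proof -
    have "mat_trace ((A x - S i) * ?N x) = mat_trace (((A x - S i) * rprod As x) * wp u)"
      using carr[of x] by (simp add: as c)
    also have "\<dots> = mat_trace (wp u * ((A x - S i) * rprod As x))"
      using carr[of x] by (intro mat_trace_comm[of _ p]) (auto simp: c)
    also have "wp u * ((A x - S i) * rprod As x) = wp u * (A x * rprod As x) - wp u * (S i * rprod As x)"
      using carr[of x]
      by (simp add: minus_mult_distrib_mat[of _ p p _ _ p] mult_minus_distrib_mat[of _ p p _ p] c)
    also have "mat_trace \<dots> = mat_trace (wp u * (A x * rprod As x)) - mat_trace (wp u * (S i * rprod As x))"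
      using carr[of x] by (intro mat_trace_diff[of _ p]) (auto simp: c)
    finally show ?thesis
      using carr[of x] by (simp add: a wp_append as c)
  qed
  have Nm: "rmat p M (rprod As)"
    using rmat_compose[OF indep_id_measurable(2)[OF F_indep[OF obs(4) indices_subset[OF obs(3)] obs(2)]] rmat_rprod[OF obs(3)]] .
  have Am: "rmat p M A"
    using rmat_compose[OF indep_id_measurable(1)[OF F_indep[OF obs(4) indices_subset[OF obs(3)] obs(2)]], of p A] obs(1)
    by (simp add: observed_def)
  have "?D \<in> borel_measurable M" "?E \<in> borel_measurable M"
    by (intro borel_measurable_diff borel_measurable_const rmat_trace[of p] rmat_mult rmat_diff rmat_const Nm Am wp_carrier S_carrier)+
  then have meas: "(\<lambda>x. ennreal ((?D x)\<^sup>2)) \<in> borel_measurable M" "(\<lambda>x. ennreal ((?E x)\<^sup>2)) \<in> borel_measurable M"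
    by (auto intro!: measurable_compose[OF _ measurable_ennreal] borel_measurable_power)
  have "(\<integral>\<^sup>+x. ennreal ((?D x + ?E x)\<^sup>2) \<partial>M) \<le> (\<integral>\<^sup>+x. 2 * ennreal ((?D x)\<^sup>2) + 2 * ennreal ((?E x)\<^sup>2) \<partial>M)"
  proof (rule nn_integral_mono)
    fix x
    have "(?D x + ?E x)\<^sup>2 \<le> 2 * (?D x)\<^sup>2 + 2 * (?E x)\<^sup>2"
      using sum_squares_bound[of "?D x" "?E x"] by (simp add: power2_sum)
    then have "ennreal ((?D x + ?E x)\<^sup>2) \<le> ennreal (2 * (?D x)\<^sup>2 + 2 * (?E x)\<^sup>2)"
      by (rule ennreal_leI)
    then show "ennreal ((?D x + ?E x)\<^sup>2) \<le> 2 * ennreal ((?D x)\<^sup>2) + 2 * ennreal ((?E x)\<^sup>2)"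
      by (simp add: ennreal_mult')
  qed
  also have "\<dots> = 2 * (\<integral>\<^sup>+x. ennreal ((?D x)\<^sup>2) \<partial>M) + 2 * (\<integral>\<^sup>+x. ennreal ((?E x)\<^sup>2) \<partial>M)"
    unfolding nn_integral_cmult[OF meas(1), symmetric] nn_integral_cmult[OF meas(2), symmetric]
    by (intro nn_integral_add borel_measurable_times_ennreal borel_measurable_const meas)
  also have "\<dots> \<le> 2 * ennreal (2 * (\<kappa> * L * R ^ q)) + 2 * ennreal (8 ^ length As * (\<kappa> * L * R ^ q))"
    using D E by (intro add_mono mult_left_mono) auto
  also have "\<dots> = ennreal (4 * (\<kappa> * L * R ^ q) + 2 * 8 ^ length As * (\<kappa> * L * R ^ q))"
    using \<kappa> L_nonneg R_ge_1 by (simp add: ennreal_mult'[symmetric] ennreal_plus[symmetric] del: ennreal_plus flip: ennreal_numeral)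
  also have "\<dots> \<le> ennreal (8 ^ length (a # As) * (\<kappa> * L * R ^ q))"
  proof (rule ennreal_leI)
    \<comment> \<open>The inequality (D + E)^2 \<le> 2 D^2 + 2 E^2 with the bounds for both squares
      asks for constants c with 4 + 2 c(k) \<le> c(k + 1) and c(0) \<ge> 0; powers of 8 are a
      convenient choice.\<close>
    have "4 + 2 * 8 ^ length As \<le> (8 :: real) ^ length (a # As)"
    proof -
      have "1 \<le> (8 :: real) ^ length As" by (rule one_le_power) simp
      then show ?thesis unfolding length_Cons power_Suc by linarith
    qed
    moreover have "0 \<le> \<kappa> * L * R ^ q"
      using \<kappa> L_nonneg R_ge_1 by simp
    ultimately have "(4 + 2 * 8 ^ length As) * (\<kappa> * L * R ^ q) \<le> 8 ^ length (a # As) * (\<kappa> * L * R ^ q)"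
      by (rule mult_right_mono)
    then show "4 * (\<kappa> * L * R ^ q) + 2 * 8 ^ length As * (\<kappa> * L * R ^ q) \<le> 8 ^ length (a # As) * (\<kappa> * L * R ^ q)"
      by (simp add: algebra_simps)
  qed
  finally show ?case unfolding split .
qed

end

section \<open>Gaussian moments\<close>

lemma pos_def_imp_psd: "pos_def p A \<Longrightarrow> psd p A"
  unfolding pos_def_def psd_def
proof (intro conjI ballI)
  fix v :: "real vec" assume A: "A \<in> carrier_mat p p \<and> transpose_mat A = A \<and>
      (\<forall>a \<in> carrier_vec p. a \<noteq> 0\<^sub>v p \<longrightarrow> a \<bullet> (A *\<^sub>v a) > 0)" and v: "v \<in> carrier_vec p"
  show "0 \<le> v \<bullet> (A *\<^sub>v v)"
  proof (cases "v = 0\<^sub>v p")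
    case True
    then show ?thesis using A by (auto simp: mult_mat_vec_carrier[of _ p p])
  next
    case False
    then show ?thesis using A v by (auto intro: less_imp_le)
  qed
qed auto

lemma space_borel_vec [simp]: "space (borel_vec p) = carrier_vec p"
  by (simp add: borel_vec_def)

lemma measurable_vec_index:
  assumes "a < p"
  shows "(\<lambda>v. v $ a) \<in> borel_measurable (borel_vec p)"
proof -
  have "(\<lambda>v. (\<lambda>i\<in>{..<p}. v $ i) a) \<in> borel_measurable (borel_vec p)"
    unfolding borel_vec_def
  proof (rule measurable_compose[OF measurable_vimage_algebra1 measurable_component_singleton])
    show "(\<lambda>v. \<lambda>i\<in>{..<p}. v $ i) \<in> carrier_vec p \<rightarrow> space (\<Pi>\<^sub>M i\<in>{..<p}. (borel :: real measure))"
      unfolding space_PiM by (rule Pi_I, rule restrict_PiE_iff[THEN iffD2]) simp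
  qed (use assms in simp)
  then show ?thesis using assms by simp
qed

lemma measurable_scalar_prod:
  assumes "c \<in> carrier_vec p"
  shows "(\<lambda>v. c \<bullet> v) \<in> borel_measurable (borel_vec p)"
proof -
  have "(\<lambda>v. \<Sum>a<p. c $ a * v $ a) \<in> borel_measurable (borel_vec p)"
    by (intro borel_measurable_sum borel_measurable_times measurable_vec_index) auto
  then show ?thesis
    by (subst measurable_cong[where g = "\<lambda>v. \<Sum>a<p. c $ a * v $ a"])
      (auto simp: scalar_prod_def atLeast0LessThan)
qed

lemma (in prob_space) normal_central_moments:
  assumes D: "distributed M lborel Y (normal_density \<mu> \<sigma>)" and \<sigma>: "0 < \<sigma>"
  shows "has_bochner_integral M (\<lambda>x. (Y x - \<mu>) ^ 2) (\<sigma>\<^sup>2)"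
    and "has_bochner_integral M (\<lambda>x. (Y x - \<mu>) ^ 4) (3 * (\<sigma>\<^sup>2)\<^sup>2)"
proof -
  have moment: "has_bochner_integral M (\<lambda>x. (Y x - \<mu>) ^ (2 * k)) (fact (2 * k) / ((2 / \<sigma>\<^sup>2) ^ k * fact k))" for k
    using normal_moment_even[OF \<sigma>, of \<mu> k]
      distributed_integrable[OF D, of "\<lambda>y. (y - \<mu>) ^ (2 * k)"]
      distributed_integral[OF D, of "\<lambda>y. (y - \<mu>) ^ (2 * k)"]
    by (auto simp: has_bochner_integral_iff)
  show "has_bochner_integral M (\<lambda>x. (Y x - \<mu>) ^ 2) (\<sigma>\<^sup>2)"
    using moment[of 1] by (simp add: fact_numeral)
  show "has_bochner_integral M (\<lambda>x. (Y x - \<mu>) ^ 4) (3 * (\<sigma>\<^sup>2)\<^sup>2)"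
    using moment[of 2] \<sigma> by (simp add: fact_numeral power_divide field_simps)
qed

text \<open>Indices are pairs of an observation and a component, so that all coordinates of an
  independent sample form one Gaussian family with this covariance.\<close>

definition cov_kernel :: "real mat \<Rightarrow> 'i \<times> nat \<Rightarrow> 'i \<times> nat \<Rightarrow> real" where
  "cov_kernel \<Sigma> s t = (if fst s = fst t then \<Sigma> $$ (snd s, snd t) else 0)"

text \<open>Grouped by observation, the form is a sum of independent normal variables and hence
  normal with variance \<open>v\<close>; its moments are those of a one-dimensional normal
  law.\<close>

lemma (in prob_space) gaussian_linear_form_moments:
  fixes Z :: "'i \<Rightarrow> 'a \<Rightarrow> real vec" and c :: "'i \<times> nat \<Rightarrow> real"
  assumes J: "finite J" and ind: "indep_vars (\<lambda>_. borel_vec p) Z J"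
    and normal: "\<And>i. i \<in> J \<Longrightarrow> mv_normal M p \<mu> \<Sigma> (Z i)"
    and \<mu>: "\<mu> \<in> carrier_vec p" and \<Sigma>: "pos_def p \<Sigma>"
  defines "U \<equiv> \<lambda>x. \<Sum>s\<in>J \<times> {..<p}. c s * (Z (fst s) x $ snd s - \<mu> $ snd s)"
    and "v \<equiv> \<Sum>s\<in>J \<times> {..<p}. \<Sum>t\<in>J \<times> {..<p}. c s * c t * cov_kernel \<Sigma> s t"
  shows "has_bochner_integral M (\<lambda>x. U x ^ 2) v" "has_bochner_integral M (\<lambda>x. U x ^ 4) (3 * v\<^sup>2)"
proof -
  define h where "h i = vec p (\<lambda>a. c (i, a))" for i
  define q where "q i = h i \<bullet> (\<Sigma> *\<^sub>v h i)" for i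
  \<comment> \<open>\<open>mv_normal\<close> speaks of nonzero linear forms, and a normal density
    needs a positive deviation. Observations whose coefficients all vanish are therefore
    dropped.\<close>
  define J' where "J' = {i\<in>J. h i \<noteq> 0\<^sub>v p}"
  have \<Sigma>c: "\<Sigma> \<in> carrier_mat p p" using \<Sigma> by (simp add: pos_def_def)
  have h: "h i \<in> carrier_vec p" for i by (simp add: h_def)
  have rv: "Z i \<in> M \<rightarrow>\<^sub>M borel_vec p" if "i \<in> J" for i
    using normal[OF that] by (simp add: mv_normal_def)
  have Zc: "Z i x \<in> carrier_vec p" if "i \<in> J" "x \<in> space M" for i x
    using measurable_space[OF rv[OF that(1)] that(2)] by simp
  have U: "U x = (\<Sum>i\<in>J'. h i \<bullet> Z i x) - (\<Sum>i\<in>J'. h i \<bullet> \<mu>)" if x: "x \<in> space M" for x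
  proof -
    have "U x = (\<Sum>i\<in>J. \<Sum>a<p. c (i, a) * (Z i x $ a - \<mu> $ a))"
      by (simp add: U_def sum.cartesian_product split_def)
    also have "\<dots> = (\<Sum>i\<in>J. h i \<bullet> Z i x - h i \<bullet> \<mu>)"
    proof (intro sum.cong refl)
      fix i assume "i \<in> J"
      then have "h i \<bullet> Z i x = (\<Sum>a<p. c (i, a) * Z i x $ a)" "h i \<bullet> \<mu> = (\<Sum>a<p. c (i, a) * \<mu> $ a)"
        using \<mu> Zc[OF _ x, of i] by (auto simp: scalar_prod_def h_def atLeast0LessThan)
      then show "(\<Sum>a<p. c (i, a) * (Z i x $ a - \<mu> $ a)) = h i \<bullet> Z i x - h i \<bullet> \<mu>"
        by (simp add: right_diff_distrib sum_subtractf)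
    qed
    also have "\<dots> = (\<Sum>i\<in>J'. h i \<bullet> Z i x - h i \<bullet> \<mu>)"
      using J \<mu> Zc[OF _ x] by (intro sum.mono_neutral_right) (auto simp: J'_def)
    finally show ?thesis by (simp add: sum_subtractf)
  qed
  have q: "q i = (\<Sum>a<p. \<Sum>b<p. c (i, a) * c (i, b) * \<Sigma> $$ (a, b))" for i
    using \<Sigma>c by (auto simp: q_def h_def scalar_prod_def mult_mat_vec_def atLeast0LessThan sum_distrib_left row_def
        intro!: sum.cong)
  have v: "v = (\<Sum>i\<in>J'. q i)"
  proof -
    have "v = (\<Sum>i\<in>J. \<Sum>a<p. \<Sum>j\<in>J. \<Sum>b<p. if i = j then c (i, a) * c (j, b) * \<Sigma> $$ (a, b) else 0)"
      unfolding v_def sum.cartesian_product' by (intro sum.cong refl) (auto simp: cov_kernel_def)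
    also have "\<dots> = (\<Sum>i\<in>J. \<Sum>a<p. \<Sum>j\<in>J. if i = j then \<Sum>b<p. c (i, a) * c (j, b) * \<Sigma> $$ (a, b) else 0)"
      by (intro sum.cong refl) auto
    also have "\<dots> = (\<Sum>i\<in>J. q i)"
      using J by (simp add: q)
    also have "\<dots> = (\<Sum>i\<in>J'. q i)"
      using J \<Sigma>c by (intro sum.mono_neutral_right) (auto simp: J'_def q_def)
    finally show ?thesis .
  qed
  have "has_bochner_integral M (\<lambda>x. U x ^ 2) v \<and> has_bochner_integral M (\<lambda>x. U x ^ 4) (3 * v\<^sup>2)"
  proof (cases "J' = {}")
    \<comment> \<open>The degenerate form has no density, but \<open>U\<close> and \<open>v\<close>
      are both 0.\<close>
    case True
    have "has_bochner_integral M (\<lambda>x. U x ^ k) 0 \<longleftrightarrow> has_bochner_integral M (\<lambda>x. 0 :: real) 0" if "0 < k" for k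
      using U True that by (intro has_bochner_integral_cong refl) (auto simp: zero_power)
    then show ?thesis using v True by (simp add: has_bochner_integral_zero)
  next
    case False
    have fin: "finite J'" using J by (simp add: J'_def)
    have qpos: "0 < q i" if "i \<in> J'" for i
      using \<Sigma> h that by (auto simp: pos_def_def q_def J'_def)
    have "indep_vars (\<lambda>_. borel_vec p) Z J'"
      using ind by (rule indep_vars_subset) (auto simp: J'_def)
    then have "indep_vars (\<lambda>_. borel) (\<lambda>i x. h i \<bullet> Z i x) J'"
      by (rule indep_vars_compose2) (rule measurable_scalar_prod[OF h])
    then have D: "distributed M lborel (\<lambda>x. \<Sum>i\<in>J'. h i \<bullet> Z i x)
        (normal_density (\<Sum>i\<in>J'. h i \<bullet> \<mu>) (sqrt (\<Sum>i\<in>J'. (sqrt (q i))\<^sup>2)))"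
      using qpos normal h
      by (intro sum_indep_normal fin False) (auto simp: J'_def mv_normal_def q_def)
    have "(\<Sum>i\<in>J'. (sqrt (q i))\<^sup>2) = v"
      unfolding v using qpos by (intro sum.cong refl) (auto intro: less_imp_le)
    moreover have vpos: "0 < v"
      unfolding v using fin False qpos by (intro sum_pos) auto
    ultimately have D: "distributed M lborel (\<lambda>x. \<Sum>i\<in>J'. h i \<bullet> Z i x) (normal_density (\<Sum>i\<in>J'. h i \<bullet> \<mu>) (sqrt v))"
      using D by simp
    have "has_bochner_integral M (\<lambda>x. U x ^ 2) v"
      "has_bochner_integral M (\<lambda>x. U x ^ 4) (3 * v\<^sup>2)"
      using normal_central_moments[OF D] vpos
      by (auto cong: has_bochner_integral_cong simp: U)
    then show ?thesis by simp
  qed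
  then show "has_bochner_integral M (\<lambda>x. U x ^ 2) v" "has_bochner_integral M (\<lambda>x. U x ^ 4) (3 * v\<^sup>2)"
    by auto
qed

text \<open>Coefficients written as sums of indicators cover coinciding indices without a case
  distinction.\<close>

lemma sum_four_deltas:
  fixes f :: "'s \<Rightarrow> real"
  assumes "finite S" "s1 \<in> S" "s2 \<in> S" "s3 \<in> S" "s4 \<in> S"
  shows "(\<Sum>s\<in>S. (e1 * of_bool (s = s1) + e2 * of_bool (s = s2) + e3 * of_bool (s = s3) + e4 * of_bool (s = s4)) * f s)
    = e1 * f s1 + e2 * f s2 + e3 * f s3 + e4 * f s4"
proof -
  have d: "(\<Sum>s\<in>S. e * of_bool (s = t) * f s) = e * f t" if "t \<in> S" for e t
  proof -
    have "(\<Sum>s\<in>S. e * of_bool (s = t) * f s) = (\<Sum>s\<in>S. if s = t then e * f t else 0)"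
      by (intro sum.cong) auto
    then show ?thesis using assms(1) that by simp
  qed
  show ?thesis
    using assms by (simp only: ring_distribs sum.distrib d)
qed

text \<open>Summing over the signs of b, c, d with their product as weight kills every monomial of
  degree 4 that is not odd in all three. Only a b c d survives, with coefficient 4! times the 8 sign
  patterns.\<close>

lemma fourth_power_polarization: "192 * (a * b * c * d) = (a + b + c + d) ^ 4 - (a + b + c - d) ^ 4 - (a + b - c + d) ^ 4 - (a - b + c + d) ^ 4
      + (a + b - c - d) ^ 4 + (a - b + c - d) ^ 4 + (a - b - c + d) ^ 4 - (a - b - c - d) ^ 4" 
    for a b c d :: real
proof -
  have 1: "(x + d) ^ 4 - (x - d) ^ 4 = 8 * d * (x ^ 3 + x * d ^ 2)" for x
    by (simp add: power4_eq_xxxx power3_eq_cube power2_eq_square algebra_simps)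
  have 2: "(y + c) ^ 3 - (y - c) ^ 3 = 6 * y ^ 2 * c + 2 * c ^ 3" for y
    by (simp add: power3_eq_cube power2_eq_square algebra_simps)
  have "(a + b + c + d) ^ 4 - (a + b + c - d) ^ 4 - (a + b - c + d) ^ 4 - (a - b + c + d) ^ 4
      + (a + b - c - d) ^ 4 + (a - b + c - d) ^ 4 + (a - b - c + d) ^ 4 - (a - b - c - d) ^ 4
    = ((a + b + c + d) ^ 4 - (a + b + c - d) ^ 4) - ((a + b - c + d) ^ 4 - (a + b - c - d) ^ 4)
      - ((a - b + c + d) ^ 4 - (a - b + c - d) ^ 4) + ((a - b - c + d) ^ 4 - (a - b - c - d) ^ 4)"
    by simp
  also have "\<dots> = 8 * d * (((a + b + c) ^ 3 - (a + b - c) ^ 3) - ((a - b + c) ^ 3 - (a - b - c) ^ 3))"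
    unfolding 1 by (simp add: algebra_simps)
  also have "\<dots> = 192 * (a * b * c * d)"
    unfolding 2 by (simp add: power2_eq_square algebra_simps)
  finally show ?thesis by simp
qed

text \<open>The same signed sum applied to the fourth moments 3 v^2. Here \<open>D\<close> is the
  sum of the four variances, and a, b, c, d, f, g are the covariances of the pairs 12, 13, 14, 23,
  24, 34; what remains are the three pairings.\<close>

lemma pairing_polarization:
  fixes a b c d f g D :: real
  shows "1 / 192 * (3 * (D + 2 * (a + b + c + d + f + g))\<^sup>2 - 3 * (D + 2 * (a + b - c + d - f - g))\<^sup>2
    - 3 * (D + 2 * (a - b + c - d + f - g))\<^sup>2 - 3 * (D + 2 * (- a + b + c - d - f + g))\<^sup>2
    + 3 * (D + 2 * (a - b - c - d - f + g))\<^sup>2 + 3 * (D + 2 * (- a + b - c - d + f - g))\<^sup>2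
    + 3 * (D + 2 * (- a - b + c + d - f - g))\<^sup>2 - 3 * (D + 2 * (- a - b - c + d + f + g))\<^sup>2) = a * g + b * f + c * d"
  by (simp add: power2_eq_square algebra_simps)

text \<open>Wick's formula by polarization: the product of four numbers is a combination of fourth powers of their signed sums.\<close>

lemma (in prob_space) gaussian_wick:
  fixes Z :: "'i \<Rightarrow> 'a \<Rightarrow> real vec"
  assumes J: "finite J" and ind: "indep_vars (\<lambda>_. borel_vec p) Z J"
    and normal: "\<And>i. i \<in> J \<Longrightarrow> mv_normal M p \<mu> \<Sigma> (Z i)"
    and \<mu>: "\<mu> \<in> carrier_vec p" and \<Sigma>: "pos_def p \<Sigma>"
    and s: "s1 \<in> J \<times> {..<p}" "s2 \<in> J \<times> {..<p}" "s3 \<in> J \<times> {..<p}" "s4 \<in> J \<times> {..<p}"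
  defines "z \<equiv> \<lambda>s x. Z (fst s) x $ snd s - \<mu> $ snd s"
    and "k \<equiv> cov_kernel \<Sigma>"
  shows "has_bochner_integral M (\<lambda>x. z s1 x * z s2 x) (k s1 s2)"
    and "has_bochner_integral M (\<lambda>x. z s1 x * z s2 x * z s3 x * z s4 x)
      (k s1 s2 * k s3 s4 + k s1 s3 * k s2 s4 + k s1 s4 * k s2 s3)"
proof -
  let ?S = "J \<times> {..<p}"
  have fin: "finite ?S" using J by simp
  have sym: "k s t = k t s" if "s \<in> ?S" "t \<in> ?S" for s t
    using that \<Sigma> mat_symD[of \<Sigma> p "snd s" "snd t"] by (auto simp: k_def cov_kernel_def pos_def_def)
  define l where "l e1 e2 e3 e4 x = e1 * z s1 x + e2 * z s2 x + e3 * z s3 x + e4 * z s4 x" for e1 e2 e3 e4 :: real and x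
  define v where "v e1 e2 e3 e4 = e1\<^sup>2 * k s1 s1 + e2\<^sup>2 * k s2 s2 + e3\<^sup>2 * k s3 s3 + e4\<^sup>2 * k s4 s4
      + 2 * (e1 * e2 * k s1 s2 + e1 * e3 * k s1 s3 + e1 * e4 * k s1 s4 + e2 * e3 * k s2 s3 + e2 * e4 * k s2 s4 + e3 * e4 * k s3 s4)"
    for e1 e2 e3 e4 :: real
  have m: "has_bochner_integral M (\<lambda>x. l e1 e2 e3 e4 x ^ 2) (v e1 e2 e3 e4)"
    "has_bochner_integral M (\<lambda>x. l e1 e2 e3 e4 x ^ 4) (3 * (v e1 e2 e3 e4)\<^sup>2)" for e1 e2 e3 e4
  proof -
    let ?c = "\<lambda>s. e1 * of_bool (s = s1) + e2 * of_bool (s = s2) + e3 * of_bool (s = s3) + e4 * of_bool (s = s4)"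
    note d = sum_four_deltas[OF fin s, of e1 e2 e3 e4]
    have 1: "(\<Sum>s\<in>?S. ?c s * (Z (fst s) x $ snd s - \<mu> $ snd s)) = l e1 e2 e3 e4 x" for x
      unfolding d l_def z_def by simp
    have "(\<Sum>s\<in>?S. \<Sum>t\<in>?S. ?c s * ?c t * k s t) = (\<Sum>s\<in>?S. ?c s * (\<Sum>t\<in>?S. ?c t * k s t))"
      by (simp add: sum_distrib_left mult.assoc)
    also have "\<dots> = v e1 e2 e3 e4"
      unfolding d v_def sym[OF s(2,1)] sym[OF s(3,1)] sym[OF s(4,1)] sym[OF s(3,2)] sym[OF s(4,2)] sym[OF s(4,3)]
      by (simp add: algebra_simps power2_eq_square)
    finally show "has_bochner_integral M (\<lambda>x. l e1 e2 e3 e4 x ^ 2) (v e1 e2 e3 e4)"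
      "has_bochner_integral M (\<lambda>x. l e1 e2 e3 e4 x ^ 4) (3 * (v e1 e2 e3 e4)\<^sup>2)"
      using gaussian_linear_form_moments[OF J ind normal \<mu> \<Sigma>, of ?c] unfolding 1 k_def by auto
  qed
  have "has_bochner_integral M (\<lambda>x. 1 / 4 * (l 1 1 0 0 x ^ 2 - l 1 (-1) 0 0 x ^ 2)) (1 / 4 * (v 1 1 0 0 - v 1 (-1) 0 0))"
    by (intro has_bochner_integral_mult_right has_bochner_integral_diff m)
  moreover have "1 / 4 * (l 1 1 0 0 x ^ 2 - l 1 (-1) 0 0 x ^ 2) = z s1 x * z s2 x" for x
    by (simp add: l_def power2_eq_square algebra_simps)
  moreover have "1 / 4 * (v 1 1 0 0 - v 1 (-1) 0 0) = k s1 s2"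
    by (simp add: v_def)
  ultimately show "has_bochner_integral M (\<lambda>x. z s1 x * z s2 x) (k s1 s2)"
    by simp
  let ?D = "k s1 s1 + k s2 s2 + k s3 s3 + k s4 s4"
  have v4:
    "v 1 1 1 1 = ?D + 2 * (k s1 s2 + k s1 s3 + k s1 s4 + k s2 s3 + k s2 s4 + k s3 s4)"
    "v 1 1 1 (-1) = ?D + 2 * (k s1 s2 + k s1 s3 - k s1 s4 + k s2 s3 - k s2 s4 - k s3 s4)"
    "v 1 1 (-1) 1 = ?D + 2 * (k s1 s2 - k s1 s3 + k s1 s4 - k s2 s3 + k s2 s4 - k s3 s4)"
    "v 1 (-1) 1 1 = ?D + 2 * (- k s1 s2 + k s1 s3 + k s1 s4 - k s2 s3 - k s2 s4 + k s3 s4)"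
    "v 1 1 (-1) (-1) = ?D + 2 * (k s1 s2 - k s1 s3 - k s1 s4 - k s2 s3 - k s2 s4 + k s3 s4)"
    "v 1 (-1) 1 (-1) = ?D + 2 * (- k s1 s2 + k s1 s3 - k s1 s4 - k s2 s3 + k s2 s4 - k s3 s4)"
    "v 1 (-1) (-1) 1 = ?D + 2 * (- k s1 s2 - k s1 s3 + k s1 s4 + k s2 s3 - k s2 s4 - k s3 s4)"
    "v 1 (-1) (-1) (-1) = ?D + 2 * (- k s1 s2 - k s1 s3 - k s1 s4 + k s2 s3 + k s2 s4 + k s3 s4)"
    by (simp_all add: v_def)
  have "has_bochner_integral M (\<lambda>x. 1 / 192 * (l 1 1 1 1 x ^ 4 - l 1 1 1 (-1) x ^ 4 - l 1 1 (-1) 1 x ^ 4 - l 1 (-1) 1 1 x ^ 4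
      + l 1 1 (-1) (-1) x ^ 4 + l 1 (-1) 1 (-1) x ^ 4 + l 1 (-1) (-1) 1 x ^ 4 - l 1 (-1) (-1) (-1) x ^ 4))
    (1 / 192 * (3 * (v 1 1 1 1)\<^sup>2 - 3 * (v 1 1 1 (-1))\<^sup>2 - 3 * (v 1 1 (-1) 1)\<^sup>2 - 3 * (v 1 (-1) 1 1)\<^sup>2
      + 3 * (v 1 1 (-1) (-1))\<^sup>2 + 3 * (v 1 (-1) 1 (-1))\<^sup>2 + 3 * (v 1 (-1) (-1) 1)\<^sup>2 - 3 * (v 1 (-1) (-1) (-1))\<^sup>2))"
    by (intro has_bochner_integral_mult_right has_bochner_integral_diff has_bochner_integral_add m)
  also have "(\<lambda>x. 1 / 192 * (l 1 1 1 1 x ^ 4 - l 1 1 1 (-1) x ^ 4 - l 1 1 (-1) 1 x ^ 4 - l 1 (-1) 1 1 x ^ 4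
      + l 1 1 (-1) (-1) x ^ 4 + l 1 (-1) 1 (-1) x ^ 4 + l 1 (-1) (-1) 1 x ^ 4 - l 1 (-1) (-1) (-1) x ^ 4))
    = (\<lambda>x. z s1 x * z s2 x * z s3 x * z s4 x)"
  proof
    fix x
    show "1 / 192 * (l 1 1 1 1 x ^ 4 - l 1 1 1 (-1) x ^ 4 - l 1 1 (-1) 1 x ^ 4 - l 1 (-1) 1 1 x ^ 4
      + l 1 1 (-1) (-1) x ^ 4 + l 1 (-1) 1 (-1) x ^ 4 + l 1 (-1) (-1) 1 x ^ 4 - l 1 (-1) (-1) (-1) x ^ 4)
      = z s1 x * z s2 x * z s3 x * z s4 x"
      using fourth_power_polarization[of "z s1 x" "z s2 x" "z s3 x" "z s4 x"] by (simp add: l_def)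
  qed
  also have "1 / 192 * (3 * (v 1 1 1 1)\<^sup>2 - 3 * (v 1 1 1 (-1))\<^sup>2 - 3 * (v 1 1 (-1) 1)\<^sup>2 - 3 * (v 1 (-1) 1 1)\<^sup>2
      + 3 * (v 1 1 (-1) (-1))\<^sup>2 + 3 * (v 1 (-1) 1 (-1))\<^sup>2 + 3 * (v 1 (-1) (-1) 1)\<^sup>2 - 3 * (v 1 (-1) (-1) (-1))\<^sup>2)
    = k s1 s2 * k s3 s4 + k s1 s3 * k s2 s4 + k s1 s4 * k s2 s3"
    unfolding v4 by (rule pairing_polarization)
  finally show "has_bochner_integral M (\<lambda>x. z s1 x * z s2 x * z s3 x * z s4 x)
      (k s1 s2 * k s3 s4 + k s1 s3 * k s2 s4 + k s1 s4 * k s2 s3)" .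
qed

lemma (in prob_space) trace_pos_covariance:
  assumes normal: "mv_normal M p \<mu> \<Sigma> Z" and \<mu>: "\<mu> \<in> carrier_vec p" and \<Sigma>: "pos_def p \<Sigma>"
  shows "trace_pos p \<Sigma>"
proof -
  have rv: "Z \<in> M \<rightarrow>\<^sub>M borel_vec p"
    using normal by (simp add: mv_normal_def)
  \<comment> \<open>A single vector counts as an independent family over a one-point index type,
    which makes \<open>gaussian_wick\<close> applicable.\<close>
  have ind: "indep_vars (\<lambda>_. borel_vec p) (\<lambda>_::unit. Z) {()}"
    unfolding indep_vars_def2
  proof (intro conjI ballI indep_setsI)
    fix A J assume "J \<noteq> {}" "J \<subseteq> {()}"
    then have "J = {()}" by auto
    then show "prob (\<Inter>j\<in>J. A j) = (\<Prod>j\<in>J. prob (A j))" by simp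
  qed (use rv in \<open>auto intro: measurable_sets\<close>)
  have \<Sigma>c: "\<Sigma> \<in> carrier_mat p p" "transpose_mat \<Sigma> = \<Sigma>"
    using \<Sigma> by (auto simp: pos_def_def)
  define z where "z a x = Z x $ a - \<mu> $ a" for a x
  \<comment> \<open>The last two indices are fillers: both parts of \<open>gaussian_wick\<close>
    share its four index hypotheses.\<close>
  have cov: "has_bochner_integral M (\<lambda>x. z a x * z b x) (\<Sigma> $$ (a, b))" if "a < p" "b < p" for a b
    using gaussian_wick(1)[OF _ ind normal \<mu> \<Sigma>, of "((), a)" "((), b)" "((), a)" "((), a)"] that
    by (simp add: z_def cov_kernel_def)
  have "0 \<le> mat_trace (\<Sigma> * N)" if N: "psd p N" for N
  proof -
    have Nc: "N \<in> carrier_mat p p" using N by (simp add: psd_def)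
    have int: "has_bochner_integral M (\<lambda>x. \<Sum>a<p. \<Sum>b<p. z a x * z b x * N $$ (b, a)) (mat_trace (\<Sigma> * N))"
      unfolding mat_trace_mult[OF \<Sigma>c(1) Nc]
      by (intro has_bochner_integral_sum has_bochner_integral_mult_left cov) auto
    have "0 \<le> (\<Sum>a<p. \<Sum>b<p. z a x * z b x * N $$ (b, a))" for x
    proof -
      let ?v = "vec p (\<lambda>a. z a x)"
      have "?v \<bullet> (N *\<^sub>v ?v) = (\<Sum>b<p. \<Sum>a<p. z a x * z b x * N $$ (b, a))"
        using Nc by (auto simp: scalar_prod_def atLeast0LessThan sum_distrib_left intro!: sum.cong)
      then have "?v \<bullet> (N *\<^sub>v ?v) = (\<Sum>a<p. \<Sum>b<p. z a x * z b x * N $$ (b, a))"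
        by (subst sum.swap)
      moreover have "0 \<le> ?v \<bullet> (N *\<^sub>v ?v)"
        using N by (auto simp: psd_def)
      ultimately show ?thesis by simp
    qed
    then have "0 \<le> (\<integral>x. (\<Sum>a<p. \<Sum>b<p. z a x * z b x * N $$ (b, a)) \<partial>M)"
      by (intro integral_nonneg_AE) auto
    then show ?thesis
      using int by (simp add: has_bochner_integral_iff)
  qed
  then show ?thesis
    using \<Sigma>c by (simp add: trace_pos_def)
qed

section \<open>Scatter matrices\<close>

text \<open>The entries of I - 11'/k, the orthogonal projection onto the vectors with sum
  zero.\<close>

definition centering :: "nat \<Rightarrow> 'i \<Rightarrow> 'i \<Rightarrow> real" where
  "centering k i j = of_bool (i = j) - 1 / real k"

text \<open>Trace and squared Frobenius norm of a projection both equal its rank. This is where the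
  degrees of freedom \<open>k - 1\<close> originate.\<close>

lemma centering_sums:
  assumes "finite I" "card I = k" "1 \<le> k"
  shows "(\<Sum>i\<in>I. centering k i i) = real k - 1" "(\<Sum>i\<in>I. \<Sum>j\<in>I. (centering k i j)\<^sup>2) = real k - 1"
proof -
  show "(\<Sum>i\<in>I. centering k i i) = real k - 1"
    using assms by (simp add: centering_def field_simps)
  have "(\<Sum>j\<in>I. (centering k i j)\<^sup>2) = (\<Sum>j\<in>I. (if i = j then 1 - 2 / real k else 0) + (1 / real k)\<^sup>2)" for i
    by (intro sum.cong) (auto simp: centering_def power2_eq_square algebra_simps)
  then have "(\<Sum>i\<in>I. \<Sum>j\<in>I. (centering k i j)\<^sup>2) = (\<Sum>i\<in>I. 1 - 2 / real k + real k * (1 / real k)\<^sup>2)"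
    using assms by (simp add: sum.distrib)
  also have "\<dots> = real k - 1"
    using assms by (simp add: power2_eq_square field_simps)
  finally show "(\<Sum>i\<in>I. \<Sum>j\<in>I. (centering k i j)\<^sup>2) = real k - 1" .
qed

lemma scatter_carrier [simp]: "scatter p I v \<in> carrier_mat p p"
  by (simp add: scatter_def)

lemma scatter_dim [simp]: "dim_row (scatter p I v) = p" "dim_col (scatter p I v) = p"
  by (simp_all add: scatter_def)

lemma smult_scatter_sym: "transpose_mat (c \<cdot>\<^sub>m scatter p I v) = c \<cdot>\<^sub>m scatter p I v"
  by (rule eq_matI) (auto simp: scatter_def mult.commute)

text \<open>Deviations from the sample mean do not change when \<mu> is subtracted first, and
  centering is idempotent, so it has to be applied on one side only. The sample mean is thus traded
  for the population mean, and the entry becomes bilinear in centred normal coordinates.\<close>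

lemma scatter_entry:
  assumes I: "finite I" "1 \<le> card I" and ab: "a < p" "b < p"
  shows "scatter p I v $$ (a, b) =
    (\<Sum>i\<in>I. \<Sum>j\<in>I. centering (card I) i j * ((v i $ a - \<mu> $ a) * (v j $ b - \<mu> $ b)))"
proof -
  let ?k = "real (card I)"
  define z where "z i a = v i $ a - \<mu> $ a" for i a
  have k: "?k \<noteq> 0" using I by auto
  have dev: "v i $ c - sample_mean p I v $ c = z i c - (\<Sum>j\<in>I. z j c) / ?k" if "c < p" for i c
    using that k by (simp add: sample_mean_def z_def sum_subtractf field_simps)
  have "scatter p I v $$ (a, b) = (\<Sum>i\<in>I. (z i a - (\<Sum>j\<in>I. z j a) / ?k) * (z i b - (\<Sum>j\<in>I. z j b) / ?k))"
    using ab by (simp add: scatter_def dev)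
  also have "\<dots> = (\<Sum>i\<in>I. z i a * z i b) - (\<Sum>i\<in>I. z i a) * (\<Sum>j\<in>I. z j b) / ?k"
  proof -
    have "(\<Sum>i\<in>I. (z i a - x / ?k) * (z i b - y / ?k)) = (\<Sum>i\<in>I. z i a * z i b) - x * y / ?k"
      if x: "x = (\<Sum>i\<in>I. z i a)" and y: "y = (\<Sum>i\<in>I. z i b)" for x y
    proof -
      have "(\<Sum>i\<in>I. (z i a - x / ?k) * (z i b - y / ?k))
         = (\<Sum>i\<in>I. z i a * z i b) - (\<Sum>i\<in>I. z i a) * (y / ?k) - (x / ?k) * (\<Sum>i\<in>I. z i b) + ?k * (x / ?k * (y / ?k))"
        by (simp add: algebra_simps sum.distrib sum_subtractf sum_distrib_left)
      also have "\<dots> = (\<Sum>i\<in>I. z i a * z i b) - x * y / ?k"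
        unfolding x[symmetric] y[symmetric] using k by (simp add: field_simps)
      finally show ?thesis .
    qed
    then show ?thesis by simp
  qed
  also have "(\<Sum>i\<in>I. z i a) * (\<Sum>j\<in>I. z j b) / ?k = (\<Sum>i\<in>I. \<Sum>j\<in>I. 1 / ?k * (z i a * z j b))"
    by (simp add: sum_product sum_divide_distrib)
  also have "(\<Sum>i\<in>I. z i a * z i b) = (\<Sum>i\<in>I. \<Sum>j\<in>I. of_bool (i = j) * (z i a * z j b))"
  proof (rule sum.cong[OF refl])
    fix i assume "i \<in> I"
    have "(\<Sum>j\<in>I. of_bool (i = j) * (z i a * z j b)) = (\<Sum>j\<in>I. if i = j then z i a * z j b else 0)"
      by (intro sum.cong) auto
    then show "z i a * z i b = (\<Sum>j\<in>I. of_bool (i = j) * (z i a * z j b))"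
      using I \<open>i \<in> I\<close> by simp
  qed
  finally show ?thesis
    by (simp add: centering_def z_def left_diff_distrib sum_subtractf)
qed

lemma rmat_scatter:
  assumes "\<And>i. i \<in> I \<Longrightarrow> Z i \<in> F \<rightarrow>\<^sub>M borel_vec p"
  shows "rmat p F (\<lambda>x. c \<cdot>\<^sub>m scatter p I (\<lambda>i. Z i x))"
proof -
  have [measurable]: "(\<lambda>x. Z i x $ a) \<in> borel_measurable F" if "i \<in> I" "a < p" for i a
    using measurable_compose[OF assms[OF that(1)] measurable_vec_index[OF that(2)]] .
  have "(\<lambda>x. (c \<cdot>\<^sub>m scatter p I (\<lambda>i. Z i x)) $$ (a, b)) \<in> borel_measurable F" if ab: "a < p" "b < p" for a b
  proof -
    have "(\<lambda>x. (c \<cdot>\<^sub>m scatter p I (\<lambda>i. Z i x)) $$ (a, b)) = (\<lambda>x. c * (\<Sum>i\<in>I. (Z i x $ a - (\<Sum>i\<in>I. Z i x $ a) / real (card I))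
        * (Z i x $ b - (\<Sum>i\<in>I. Z i x $ b) / real (card I))))"
      using ab by (simp add: scatter_def sample_mean_def)
    also have "\<dots> \<in> borel_measurable F"
      using ab by measurable
    finally show ?thesis .
  qed
  then show ?thesis by (simp add: rmat_def)
qed

text \<open>Wick's formula is summed against two copies of the centering projection. The pairing
  inside each copy gives its squared trace, the two pairings across give its squared norm. After
  division by the squared degrees of freedom the weights are 1 and \<kappa>, and the Wishart law
  itself never has to be constructed.\<close>

lemma (in prob_space) wishart_moments_scatter:
  fixes Z :: "nat \<Rightarrow> 'a \<Rightarrow> real vec"
  assumes I: "finite I" "2 \<le> card I" and ind: "indep_vars (\<lambda>_. borel_vec p) Z I"
    and normal: "\<And>i. i \<in> I \<Longrightarrow> mv_normal M p \<mu> \<Sigma> (Z i)"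
    and \<mu>: "\<mu> \<in> carrier_vec p" and \<Sigma>: "pos_def p \<Sigma>"
  shows "wishart_moments p \<Sigma> (1 / (real (card I) - 1))
    (\<lambda>x. (1 / (real (card I) - 1)) \<cdot>\<^sub>m scatter p I (\<lambda>i. Z i x))"
proof -
  let ?k = "card I" and ?P = "centering (card I)"
  let ?T = "\<lambda>x. scatter p I (\<lambda>i. Z i x)"
  define z where "z i a x = Z i x $ a - \<mu> $ a" for i a x
  have k: "1 \<le> ?k" "real ?k - 1 > 0" using I by auto
  have T: "?T x $$ (a, b) = (\<Sum>i\<in>I. \<Sum>j\<in>I. ?P i j * (z i a x * z j b x))" if "a < p" "b < p" for a b x
    using scatter_entry[OF I(1) k(1) that] by (simp add: z_def)
  have \<Sigma>c: "\<Sigma> \<in> carrier_mat p p" "transpose_mat \<Sigma> = \<Sigma>" using \<Sigma> by (auto simp: pos_def_def)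
  have P2: "?P i j * ?P j i = (?P i j)\<^sup>2" for i j :: nat
    by (auto simp: centering_def power2_eq_square)
  have E2: "has_bochner_integral M (\<lambda>x. z i a x * z j b x) (of_bool (i = j) * \<Sigma> $$ (a, b))"
    if "i \<in> I" "j \<in> I" "a < p" "b < p" for i j a b
    using gaussian_wick(1)[OF I(1) ind normal \<mu> \<Sigma>, of "(i, a)" "(j, b)" "(i, a)" "(i, a)"] that
    by (simp add: z_def cov_kernel_def of_bool_def split: if_splits)
  have E4: "has_bochner_integral M (\<lambda>x. (z i a x * z j b x) * (z k c x * z l d x))
      (of_bool (i = j) * of_bool (k = l) * (\<Sigma> $$ (a, b) * \<Sigma> $$ (c, d))
       + of_bool (i = k) * of_bool (j = l) * (\<Sigma> $$ (a, c) * \<Sigma> $$ (b, d))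
       + of_bool (i = l) * of_bool (j = k) * (\<Sigma> $$ (a, d) * \<Sigma> $$ (b, c)))"
    if "i \<in> I" "j \<in> I" "k \<in> I" "l \<in> I" "a < p" "b < p" "c < p" "d < p" for i j k l a b c d
    using gaussian_wick(2)[OF I(1) ind normal \<mu> \<Sigma>, of "(i, a)" "(j, b)" "(k, c)" "(l, d)"] that
    by (simp add: z_def cov_kernel_def of_bool_def mult.assoc if_distrib[of "\<lambda>x. x * _"] if_distrib[of "\<lambda>x. _ * x"] cong: if_cong)
  have delta: "(\<Sum>j\<in>I. of_bool (i = j) * f j) = f i" if "i \<in> I" for i and f :: "nat \<Rightarrow> real"
  proof -
    have "(\<Sum>j\<in>I. of_bool (i = j) * f j) = (\<Sum>j\<in>I. if i = j then f j else 0)"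
      by (intro sum.cong) auto
    then show ?thesis using I that by simp
  qed
  have 1: "has_bochner_integral M (\<lambda>x. ?T x $$ (a, b)) ((real ?k - 1) * \<Sigma> $$ (a, b))" if ab: "a < p" "b < p" for a b
  proof -
    have "has_bochner_integral M (\<lambda>x. ?T x $$ (a, b)) (\<Sum>i\<in>I. \<Sum>j\<in>I. ?P i j * (of_bool (i = j) * \<Sigma> $$ (a, b)))"
      unfolding T[OF ab] by (intro has_bochner_integral_sum has_bochner_integral_mult_right E2 ab)
    also have "(\<Sum>i\<in>I. \<Sum>j\<in>I. ?P i j * (of_bool (i = j) * \<Sigma> $$ (a, b))) = (\<Sum>i\<in>I. ?P i i * \<Sigma> $$ (a, b))"
      by (intro sum.cong refl) (simp add: mult.left_commute[of _ "of_bool _"] delta)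
    also have "\<dots> = (real ?k - 1) * \<Sigma> $$ (a, b)"
      using centering_sums(1)[OF I(1) refl k(1)] by (simp add: sum_distrib_right[symmetric])
    finally show ?thesis .
  qed
  have 2: "has_bochner_integral M (\<lambda>x. ?T x $$ (a, b) * ?T x $$ (c, d))
      ((real ?k - 1)\<^sup>2 * (\<Sigma> $$ (a, b) * \<Sigma> $$ (c, d))
        + (real ?k - 1) * (\<Sigma> $$ (a, c) * \<Sigma> $$ (b, d) + \<Sigma> $$ (a, d) * \<Sigma> $$ (b, c)))"
    if ab: "a < p" "b < p" and cd: "c < p" "d < p" for a b c d
  proof -
    let ?A = "\<Sigma> $$ (a, b) * \<Sigma> $$ (c, d)" and ?B = "\<Sigma> $$ (a, c) * \<Sigma> $$ (b, d)" and ?C = "\<Sigma> $$ (a, d) * \<Sigma> $$ (b, c)"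
    have expand: "?T x $$ (a, b) * ?T x $$ (c, d) = (\<Sum>i\<in>I. \<Sum>j\<in>I. \<Sum>k\<in>I. \<Sum>l\<in>I.
        (?P i j * ?P k l) * ((z i a x * z j b x) * (z k c x * z l d x)))" for x
      unfolding T[OF ab] T[OF cd] sum_distrib_right unfolding sum_distrib_left by (simp only: mult_ac)
    have "has_bochner_integral M (\<lambda>x. ?T x $$ (a, b) * ?T x $$ (c, d)) (\<Sum>i\<in>I. \<Sum>j\<in>I. \<Sum>k\<in>I. \<Sum>l\<in>I.
        (?P i j * ?P k l) * (of_bool (i = j) * of_bool (k = l) * ?A + of_bool (i = k) * of_bool (j = l) * ?B
          + of_bool (i = l) * of_bool (j = k) * ?C))"
      unfolding expand by (intro has_bochner_integral_sum has_bochner_integral_mult_right E4 ab cd)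
    also have "(\<Sum>i\<in>I. \<Sum>j\<in>I. \<Sum>k\<in>I. \<Sum>l\<in>I.
        (?P i j * ?P k l) * (of_bool (i = j) * of_bool (k = l) * ?A + of_bool (i = k) * of_bool (j = l) * ?B
          + of_bool (i = l) * of_bool (j = k) * ?C))
      = (\<Sum>i\<in>I. \<Sum>j\<in>I. \<Sum>k\<in>I. \<Sum>l\<in>I. of_bool (i = j) * (of_bool (k = l) * (?P i j * ?P k l * ?A)))
      + (\<Sum>i\<in>I. \<Sum>j\<in>I. \<Sum>k\<in>I. \<Sum>l\<in>I. of_bool (i = k) * (of_bool (j = l) * (?P i j * ?P k l * ?B)))
      + (\<Sum>i\<in>I. \<Sum>j\<in>I. \<Sum>k\<in>I. \<Sum>l\<in>I. of_bool (j = k) * (of_bool (i = l) * (?P i j * ?P k l * ?C)))"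
      by (simp only: sum.distrib[symmetric] distrib_left mult_ac)
    also have "(\<Sum>i\<in>I. \<Sum>j\<in>I. \<Sum>k\<in>I. \<Sum>l\<in>I. of_bool (i = j) * (of_bool (k = l) * (?P i j * ?P k l * ?A)))
        = (\<Sum>i\<in>I. ?P i i) * (\<Sum>k\<in>I. ?P k k) * ?A"
      by (simp add: sum_distrib_left[symmetric] delta) (subst sum_product, simp add: sum_distrib_right mult.assoc)
    also have "(\<Sum>i\<in>I. \<Sum>j\<in>I. \<Sum>k\<in>I. \<Sum>l\<in>I. of_bool (i = k) * (of_bool (j = l) * (?P i j * ?P k l * ?B)))
        = (\<Sum>i\<in>I. \<Sum>j\<in>I. (?P i j)\<^sup>2) * ?B"
      by (simp add: sum_distrib_left[symmetric] delta) (simp add: power2_eq_square sum_distrib_right)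
    also have "(\<Sum>i\<in>I. \<Sum>j\<in>I. \<Sum>k\<in>I. \<Sum>l\<in>I. of_bool (j = k) * (of_bool (i = l) * (?P i j * ?P k l * ?C)))
        = (\<Sum>i\<in>I. \<Sum>j\<in>I. (?P i j)\<^sup>2) * ?C"
      by (simp add: sum_distrib_left[symmetric] delta) (simp add: P2 sum_distrib_right)
    finally show ?thesis
      unfolding centering_sums[OF I(1) refl k(1)] by (simp add: power2_eq_square ring_distribs add.assoc)
  qed
  let ?r = "1 / (real ?k - 1)"
  have r: "?r * (real ?k - 1) = 1" using k by simp
  have "has_bochner_integral M (\<lambda>x. (?r \<cdot>\<^sub>m ?T x) $$ (a, b)) (\<Sigma> $$ (a, b))" if "a < p" "b < p" for a b
    using has_bochner_integral_mult_right[OF 1[OF that], of ?r] that k by simp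
  moreover have "has_bochner_integral M (\<lambda>x. (?r \<cdot>\<^sub>m ?T x) $$ (a, b) * (?r \<cdot>\<^sub>m ?T x) $$ (c, d))
      (\<Sigma> $$ (a, b) * \<Sigma> $$ (c, d) + ?r * (\<Sigma> $$ (a, c) * \<Sigma> $$ (b, d) + \<Sigma> $$ (a, d) * \<Sigma> $$ (b, c)))"
    if "a < p" "b < p" "c < p" "d < p" for a b c d
  proof -
    let ?A = "\<Sigma> $$ (a, b) * \<Sigma> $$ (c, d)" and ?B = "\<Sigma> $$ (a, c) * \<Sigma> $$ (b, d) + \<Sigma> $$ (a, d) * \<Sigma> $$ (b, c)"
    have "has_bochner_integral M (\<lambda>x. (?r * ?r) * (?T x $$ (a, b) * ?T x $$ (c, d)))
        ((?r * ?r) * ((real ?k - 1)\<^sup>2 * ?A + (real ?k - 1) * ?B))"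
      using 2[OF that] by (rule has_bochner_integral_mult_right)
    also have "(?r * ?r) * ((real ?k - 1)\<^sup>2 * ?A + (real ?k - 1) * ?B) = (?r * (real ?k - 1))\<^sup>2 * ?A + ?r * (?r * (real ?k - 1)) * ?B"
      by (simp only: power2_eq_square ring_distribs mult_ac)
    also have "\<dots> = ?A + ?r * ?B"
      unfolding r by simp
    finally show ?thesis using that by (simp add: mult_ac)
  qed
  ultimately show ?thesis
    using \<Sigma>c by (simp add: wishart_moments_def smult_scatter_sym)
qed

text \<open>
  Since the Gram matrix of the centred observations is annihilated by the vector of ones, its trace is also its inner
  product with the centering matrix, whose squared norm is one less than the sample size.
\<close>

lemma trace_scatter_sq_le:
  assumes I: "finite I" "1 \<le> card I"
  shows "(mat_trace (scatter p I v))\<^sup>2 \<le> (real (card I) - 1) * mat_trace (scatter p I v * scatter p I v)"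
proof -
  let ?P = "centering (card I)" and ?T = "scatter p I v"
  define y where "y i a = v i $ a - sample_mean p I v $ a" for i a
  define G where "G i j = (\<Sum>a<p. y i a * y j a)" for i j
  have T: "?T $$ (a, b) = (\<Sum>i\<in>I. y i a * y i b)" if "a < p" "b < p" for a b
    using that by (simp add: scatter_def y_def)
  have y0: "(\<Sum>i\<in>I. y i a) = 0" if "a < p" for a
    using that I by (simp add: y_def sample_mean_def sum_subtractf)
  have tr: "mat_trace ?T = (\<Sum>i\<in>I. G i i)"
  proof -
    have "mat_trace ?T = (\<Sum>a<p. \<Sum>i\<in>I. y i a * y i a)"
      by (simp add: mat_trace_def T)
    also have "\<dots> = (\<Sum>i\<in>I. G i i)"
      unfolding G_def by (rule sum.swap)
    finally show ?thesis .
  qed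
  have tr2: "mat_trace (?T * ?T) = (\<Sum>i\<in>I. \<Sum>j\<in>I. (G i j)\<^sup>2)"
  proof -
    have "mat_trace (?T * ?T) = (\<Sum>a<p. \<Sum>b<p. (\<Sum>i\<in>I. y i a * y i b) * (\<Sum>j\<in>I. y j b * y j a))"
      by (simp add: mat_trace_mult[of _ p] T)
    also have "\<dots> = (\<Sum>a<p. \<Sum>b<p. \<Sum>i\<in>I. \<Sum>j\<in>I. (y i a * y j a) * (y i b * y j b))"
      by (simp add: sum_product mult_ac)
    also have "\<dots> = (\<Sum>a<p. \<Sum>i\<in>I. \<Sum>b<p. \<Sum>j\<in>I. (y i a * y j a) * (y i b * y j b))"
      by (intro sum.cong refl sum.swap)
    also have "\<dots> = (\<Sum>a<p. \<Sum>i\<in>I. \<Sum>j\<in>I. \<Sum>b<p. (y i a * y j a) * (y i b * y j b))"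
      by (intro sum.cong refl sum.swap)
    also have "\<dots> = (\<Sum>i\<in>I. \<Sum>a<p. \<Sum>j\<in>I. \<Sum>b<p. (y i a * y j a) * (y i b * y j b))"
      by (rule sum.swap)
    also have "\<dots> = (\<Sum>i\<in>I. \<Sum>j\<in>I. \<Sum>a<p. \<Sum>b<p. (y i a * y j a) * (y i b * y j b))"
      by (intro sum.cong refl sum.swap)
    finally show ?thesis
      by (simp add: G_def power2_eq_square sum_product)
  qed
  have G0: "(\<Sum>i\<in>I. \<Sum>j\<in>I. G i j) = 0"
  proof -
    have "(\<Sum>i\<in>I. \<Sum>j\<in>I. G i j) = (\<Sum>i\<in>I. \<Sum>a<p. \<Sum>j\<in>I. y i a * y j a)"
      unfolding G_def by (intro sum.cong refl sum.swap)
    also have "\<dots> = (\<Sum>i\<in>I. \<Sum>a<p. y i a * (\<Sum>j\<in>I. y j a))"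
      by (simp add: sum_distrib_left)
    finally show ?thesis by (simp add: y0)
  qed
  have "(\<Sum>i\<in>I. \<Sum>j\<in>I. ?P i j * G i j) = (\<Sum>i\<in>I. (\<Sum>j\<in>I. if i = j then G i j else 0) - (\<Sum>j\<in>I. G i j) / real (card I))"
    unfolding sum_divide_distrib sum_subtractf[symmetric]
    by (intro sum.cong refl) (auto simp: centering_def algebra_simps)
  also have "\<dots> = mat_trace ?T"
    using I G0 by (simp add: sum_subtractf tr sum_divide_distrib[symmetric])
  finally have "(mat_trace ?T)\<^sup>2 = (\<Sum>(i, j)\<in>I \<times> I. ?P i j * G i j)\<^sup>2"
    by (simp add: sum.cartesian_product)
  also have "\<dots> \<le> (\<Sum>(i, j)\<in>I \<times> I. (?P i j)\<^sup>2) * (\<Sum>(i, j)\<in>I \<times> I. (G i j)\<^sup>2)"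
    using Cauchy_Schwarz_ineq_sum[of "\<lambda>(i, j). ?P i j" "\<lambda>(i, j). G i j" "I \<times> I"] by (simp add: split_def)
  also have "\<dots> = (real (card I) - 1) * mat_trace (?T * ?T)"
    using centering_sums(2)[OF I(1) refl I(2)] by (simp add: tr2 sum.cartesian_product[symmetric])
  finally show ?thesis .
qed

text \<open>Up to positive factors this is \<open>trace_scatter_sq_le\<close> for the whole sample;
  \<open>K \<ge> 3\<close> makes the factor \<open>K - 2\<close> positive. Nonnegativity at every
  point serves both Markov's inequality and the radicand of the statistic.\<close>

lemma sigma_hat_sq_nonneg:
  assumes "3 \<le> K"
  shows "0 \<le> sigma_hat_sq p K (sample_cov p K v)"
proof -
  let ?T = "scatter p {..<K} v" and ?c = "1 / (real K - 1)"
  have "mat_trace (?c \<cdot>\<^sub>m ?T * (?c \<cdot>\<^sub>m ?T)) = ?c\<^sup>2 * mat_trace (?T * ?T)"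
    by (simp add: mult_smult_assoc_mat[of _ p p _ p] mult_smult_distrib[of _ p p _ p] mat_trace_smult[of _ p]
        mult_carrier_mat[of _ p p _ p] power2_eq_square)
  then have "mat_trace (sample_cov p K v * sample_cov p K v) - (mat_trace (sample_cov p K v))\<^sup>2 / (real K - 1)
      = ?c\<^sup>2 * (mat_trace (?T * ?T) - (mat_trace ?T)\<^sup>2 / (real K - 1))"
    by (simp add: sample_cov_def mat_trace_smult[of _ p] power_mult_distrib power_divide right_diff_distrib)
  moreover have "(mat_trace ?T)\<^sup>2 / (real K - 1) \<le> mat_trace (?T * ?T)"
    using trace_scatter_sq_le[of "{..<K}" p v] assms by (simp add: field_simps)
  ultimately show ?thesis
    using assms by (simp add: sigma_hat_sq_def)
qed

text \<open>The correction by the squared trace is chosen such that (tr S)^2 cancels in the mean.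
  What is left is (1 + \<kappa> - 2 \<kappa>^2) tr(S S), and the prefactor of
  \<open>sigma_hat_sq\<close> inverts this coefficient.\<close>

lemma (in prob_space) sigma_hat_sq_unbiased:
  assumes A: "wishart_moments p S (1 / (real K - 1)) A" and K: "3 \<le> K"
  shows "has_bochner_integral M (\<lambda>x. sigma_hat_sq p K (A x)) (mat_trace (S * S) / real p)"
proof -
  let ?\<kappa> = "1 / (real K - 1)" and ?o = "1\<^sub>m p :: real mat"
  have S: "S \<in> carrier_mat p p" "transpose_mat S = S" and Ac: "\<And>x. A x \<in> carrier_mat p p"
    using A by (auto simp: wishart_moments_def)
  \<comment> \<open>The sandwich formula with the identity for both fixed matrices.\<close>
  have 1: "has_bochner_integral M (\<lambda>x. mat_trace (A x * A x)) ((1 + ?\<kappa>) * mat_trace (S * S) + ?\<kappa> * mat_trace S * mat_trace S)"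
    using wishart_moments_sandwich[OF A, of ?o ?o] Ac S
    by (simp add: left_mult_one_mat[of _ p p] right_mult_one_mat[of _ p p])
  have 2: "has_bochner_integral M (\<lambda>x. (mat_trace (A x))\<^sup>2) ((mat_trace S)\<^sup>2 + 2 * ?\<kappa> * mat_trace (S * S))"
  proof -
    have "has_bochner_integral M (\<lambda>x. \<Sum>a<p. \<Sum>b<p. A x $$ (a, a) * A x $$ (b, b))
      (\<Sum>a<p. \<Sum>b<p. S $$ (a, a) * S $$ (b, b) + ?\<kappa> * (S $$ (a, b) * S $$ (a, b) + S $$ (a, b) * S $$ (a, b)))"
    proof (intro has_bochner_integral_sum)
      fix a b assume "a \<in> {..<p}" "b \<in> {..<p}"
      then show "has_bochner_integral M (\<lambda>x. A x $$ (a, a) * A x $$ (b, b))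
          (S $$ (a, a) * S $$ (b, b) + ?\<kappa> * (S $$ (a, b) * S $$ (a, b) + S $$ (a, b) * S $$ (a, b)))"
        using A unfolding wishart_moments_def by blast
    qed
    also have "(\<lambda>x. \<Sum>a<p. \<Sum>b<p. A x $$ (a, a) * A x $$ (b, b)) = (\<lambda>x. (mat_trace (A x))\<^sup>2)"
      using Ac[THEN carrier_matD(1)] by (simp add: mat_trace_def power2_eq_square sum_product)
    also have "(\<Sum>a<p. \<Sum>b<p. S $$ (a, a) * S $$ (b, b) + ?\<kappa> * (S $$ (a, b) * S $$ (a, b) + S $$ (a, b) * S $$ (a, b)))
      = (\<Sum>a<p. \<Sum>b<p. S $$ (a, a) * S $$ (b, b)) + 2 * ?\<kappa> * (\<Sum>a<p. \<Sum>b<p. S $$ (a, b) * S $$ (b, a))"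
      unfolding sum_distrib_left sum.distrib[symmetric]
      by (intro sum.cong refl) (simp add: mat_symD[OF S(2,1)])
    also have "\<dots> = (mat_trace S)\<^sup>2 + 2 * ?\<kappa> * mat_trace (S * S)"
      using S carrier_matD(1)[OF S(1)]
      by (simp add: mat_trace_mult[of _ p] mat_trace_def[of S] power2_eq_square sum_product)
    finally show ?thesis .
  qed
  have "has_bochner_integral M (\<lambda>x. sigma_hat_sq p K (A x))
    ((real K - 1)\<^sup>2 / (real p * (real K - 2) * (real K + 1)) *
     ((1 + ?\<kappa>) * mat_trace (S * S) + ?\<kappa> * mat_trace S * mat_trace S
       - ((mat_trace S)\<^sup>2 + 2 * ?\<kappa> * mat_trace (S * S)) / (real K - 1)))"
    unfolding sigma_hat_sq_def
    by (intro has_bochner_integral_mult_right has_bochner_integral_diff has_bochner_integral_divide 1 2)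
  also have "(1 + ?\<kappa>) * mat_trace (S * S) + ?\<kappa> * mat_trace S * mat_trace S
       - ((mat_trace S)\<^sup>2 + 2 * ?\<kappa> * mat_trace (S * S)) / (real K - 1)
     = (1 + ?\<kappa> - 2 * ?\<kappa>\<^sup>2) * mat_trace (S * S)"
    by (simp add: power2_eq_square algebra_simps add_divide_distrib diff_divide_distrib)
  also have "1 + ?\<kappa> - 2 * ?\<kappa>\<^sup>2 = (real K - 2) * (real K + 1) / (real K - 1)\<^sup>2"
  proof -
    have "1 + 1 / d - 2 * (1 / d)\<^sup>2 = (d - 1) * (d + 2) / d\<^sup>2" if "d \<noteq> 0" for d :: real
      using that by (simp add: field_simps power2_eq_square)
    from this[of "real K - 1"] show ?thesis using K by (simp add: algebra_simps)
  qed
  finally show ?thesis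
    using K by simp
qed

section \<open>The test statistic for fixed splits\<close>

text \<open>The sigma-algebra generated by the variables with index in \<open>J\<close>, kept on the
  sample space itself, so that independence of blocks becomes independence of identity maps.\<close>

definition block_algebra :: "'a measure \<Rightarrow> ('i \<Rightarrow> 'b measure) \<Rightarrow> ('i \<Rightarrow> 'a \<Rightarrow> 'b) \<Rightarrow> 'i set \<Rightarrow> 'a measure" where
  "block_algebra M N D J = vimage_algebra (space M) (\<lambda>x. \<lambda>i\<in>J. D i x) (PiM J N)"

lemma (in prob_space) block_data_measurable:
  assumes "indep_vars N D I" "J \<subseteq> I"
  shows "(\<lambda>x. \<lambda>i\<in>J. D i x) \<in> M \<rightarrow>\<^sub>M PiM J N"
  using assms by (intro measurable_restrict) (auto simp: indep_vars_def)

lemma (in prob_space) sets_block_algebra: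
  assumes "indep_vars N D I" "J \<subseteq> I"
  shows "sets (block_algebra M N D J) = {(\<lambda>x. \<lambda>i\<in>J. D i x) -` A \<inter> space M | A. A \<in> sets (PiM J N)}"
  unfolding block_algebra_def
  using measurable_space[OF block_data_measurable[OF assms]] by (intro sets_vimage_algebra2) auto

lemma (in prob_space) block_algebra_indep:
  assumes "indep_vars N D I" "J \<subseteq> I" "K \<subseteq> I" "J \<inter> K = {}"
  shows "indep_var (block_algebra M N D J) (\<lambda>x. x) (block_algebra M N D K) (\<lambda>x. x)"
proof -
  have eq: "{(\<lambda>x. x) -` A \<inter> space M | A. A \<in> sets (block_algebra M N D H)}
      = {(\<lambda>x. \<lambda>i\<in>H. D i x) -` A \<inter> space M | A. A \<in> sets (PiM H N)}" if "H \<subseteq> I" for H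
    unfolding sets_block_algebra[OF assms(1) that] by auto
  have rv: "(\<lambda>x. x) \<in> M \<rightarrow>\<^sub>M block_algebra M N D H" if "H \<subseteq> I" for H
    unfolding block_algebra_def using block_data_measurable[OF assms(1) that]
    by (intro measurable_vimage_algebra2) auto
  show ?thesis
    using indep_var_restrict[OF assms(1,4,2,3)] rv[OF assms(2)] rv[OF assms(3)]
    unfolding indep_var_eq eq[OF assms(2)] eq[OF assms(3)] by simp
qed

lemma (in prob_space) block_data_measurable_block:
  assumes "indep_vars N D I" "J \<subseteq> K" "K \<subseteq> I"
  shows "(\<lambda>x. \<lambda>i\<in>J. D i x) \<in> block_algebra M N D K \<rightarrow>\<^sub>M PiM J N"
proof -
  have "(\<lambda>x. \<lambda>i\<in>K. D i x) \<in> block_algebra M N D K \<rightarrow>\<^sub>M PiM K N"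
    unfolding block_algebra_def
    using measurable_space[OF block_data_measurable[OF assms(1,3)]] by (intro measurable_vimage_algebra1) auto
  then have "(\<lambda>x. restrict (\<lambda>i\<in>K. D i x) J) \<in> block_algebra M N D K \<rightarrow>\<^sub>M PiM J N"
    using measurable_restrict_subset[OF assms(2)] by (rule measurable_compose)
  moreover have "restrict (\<lambda>i\<in>K. D i x) J = (\<lambda>i\<in>J. D i x)" for x
    using assms(2) by (auto simp: restrict_def fun_eq_iff)
  ultimately show ?thesis by simp
qed

lemma (in prob_space) block_algebra_mono:
  assumes "indep_vars N D I" "J \<subseteq> K" "K \<subseteq> I"
  shows "(\<lambda>x. x) \<in> block_algebra M N D K \<rightarrow>\<^sub>M block_algebra M N D J"
proof -
  have "space (block_algebra M N D K) = space M"
    by (simp add: block_algebra_def)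
  then show ?thesis
    unfolding block_algebra_def[of M N D J] using block_data_measurable_block[OF assms]
    by (intro measurable_vimage_algebra2) auto
qed

lemma (in prob_space) block_algebra_component:
  assumes "indep_vars N D I" "K \<subseteq> I" "i \<in> K"
  shows "D i \<in> block_algebra M N D K \<rightarrow>\<^sub>M N i"
  using measurable_compose[OF block_data_measurable_block[OF assms(1) order_refl assms(2)] measurable_component_singleton[OF assms(3)]]
    assms(3) by simp

text \<open>Serves to extract the independence of the \<open>X\<close> alone, or of the
  \<open>Y\<close> alone, from the joint family indexed by a disjoint sum.\<close>

lemma (in prob_space) indep_vars_reindex:
  assumes ind: "indep_vars N D (f ` J)" and inj: "inj_on f J"
  shows "indep_vars (\<lambda>j. N (f j)) (\<lambda>j. D (f j)) J"
  unfolding indep_vars_def2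
proof (intro conjI ballI indep_setsI)
  show "D (f j) \<in> M \<rightarrow>\<^sub>M N (f j)" if "j \<in> J" for j
    using ind that by (auto simp: indep_vars_def2)
  then show "{D (f j) -` A \<inter> space M | A. A \<in> sets (N (f j))} \<subseteq> events" if "j \<in> J" for j
    using that by (auto intro: measurable_sets)
  fix A H assume H: "H \<noteq> {}" "H \<subseteq> J" "finite H" and A: "\<forall>j\<in>H. A j \<in> {D (f j) -` A \<inter> space M | A. A \<in> sets (N (f j))}"
  have injH: "inj_on f H" using inj H(2) by (rule inj_on_subset)
  define A' where "A' i = A (inv_into H f i)" for i
  have A': "A' (f j) = A j" if "j \<in> H" for j
    using that injH by (simp add: A'_def)
  have "prob (\<Inter>i\<in>f ` H. A' i) = (\<Prod>i\<in>f ` H. prob (A' i))"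
  proof (rule indep_setsD)
    show "indep_sets (\<lambda>i. {D i -` A \<inter> space M | A. A \<in> sets (N i)}) (f ` J)"
      using ind by (simp add: indep_vars_def2)
  qed (use H A A' in auto)
  then show "prob (\<Inter>j\<in>H. A j) = (\<Prod>j\<in>H. prob (A j))"
    using injH by (simp add: prod.reindex A')
qed

text \<open>Markov's inequality, phrased with the nonnegative integral because the moment bounds
  come in that form.\<close>

lemma (in prob_space) prob_ge_le:
  assumes f: "f \<in> borel_measurable M" and B: "(\<integral>\<^sup>+x. ennreal (f x) \<partial>M) \<le> ennreal B" and "0 \<le> B" "0 < e"
  shows "prob {x\<in>space M. e \<le> f x} \<le> B / e"
proof -
  have "ennreal e * emeasure M {x\<in>space M. e \<le> f x} = (\<integral>\<^sup>+x. ennreal e * indicator {x\<in>space M. e \<le> f x} x \<partial>M)"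
    using f by (subst nn_integral_cmult_indicator) auto
  also have "\<dots> \<le> (\<integral>\<^sup>+x. ennreal (f x) \<partial>M)"
    by (intro nn_integral_mono) (auto simp: indicator_def intro: ennreal_leI)
  finally have "ennreal (e * prob {x\<in>space M. e \<le> f x}) \<le> ennreal B"
    using B assms(4) by (simp add: emeasure_eq_measure ennreal_mult')
  then show ?thesis
    using assms(3,4) by (simp add: field_simps)
qed

lemma (in prob_space) prob_abs_ge_le:
  assumes f: "f \<in> borel_measurable M" and B: "(\<integral>\<^sup>+x. ennreal ((f x)\<^sup>2) \<partial>M) \<le> ennreal B" and "0 \<le> B" "0 < e"
  shows "prob {x\<in>space M. e \<le> \<bar>f x\<bar>} \<le> B / e\<^sup>2"
proof -
  have "{x\<in>space M. e \<le> \<bar>f x\<bar>} = {x\<in>space M. e\<^sup>2 \<le> (f x)\<^sup>2}"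
    using assms(4) by (auto simp: abs_le_square_iff[symmetric])
  then show ?thesis
    using prob_ge_le[of "\<lambda>x. (f x)\<^sup>2" B "e\<^sup>2"] assms by simp
qed

section \<open>Deterministic bound and measurability of the statistic\<close>

lemma mat_trace_smult4:
  assumes "A \<in> carrier_mat p p" "B \<in> carrier_mat p p" "C \<in> carrier_mat p p" "D \<in> carrier_mat p p"
  shows "mat_trace ((a \<cdot>\<^sub>m A) * ((b \<cdot>\<^sub>m B) * ((c \<cdot>\<^sub>m C) * (d \<cdot>\<^sub>m D)))) = a * b * c * d * mat_trace (A * B * C * D)"
  using assms
  by (simp add: mult_smult_assoc_mat[of _ p p _ p] mult_smult_distrib[of _ p p _ p] mat_trace_smult[of _ p]
      mult_carrier_mat[of _ p p _ p] assoc_mult_mat[of _ p p _ p _ p])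

text \<open>In these ranges the radicand is at most 4 h^2 \<rho>^2 + 16 h^4, hence at most (2 h
  \<rho> + 4 h^2)^2, and the last hypothesis says that the smallest possible quotient still exceeds
  \<open>C\<close>. The lower bound on \<open>sxy\<close> keeps the root positive; a division by
  zero would yield 0.\<close>

lemma test_stat_gt:
  fixes \<theta> sxx syy sxy q C g h \<rho> :: real
  assumes "g / 2 < \<theta>" "0 \<le> sxx" "sxx \<le> \<rho>" "0 \<le> syy" "syy \<le> \<rho>" "h / 2 < sxy" "sxy < 2 * h" "0 < h" "0 < g" "0 < C"
    and q: "C * (2 * h * \<rho> + 4 * h\<^sup>2) < q * (g / 2)"
  shows "C < q * (\<theta> / sqrt (sxx * syy * sxy\<^sup>2 + sxy ^ 4))"
proof -
  let ?d = "sxx * syy * sxy\<^sup>2 + sxy ^ 4"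
  have \<rho>: "0 \<le> \<rho>" using assms by simp
  have sxy: "0 < sxy" using assms by simp
  have pos: "0 < ?d"
    using assms sxy by (intro add_nonneg_pos) auto
  have sq: "sxy\<^sup>2 \<le> (2 * h)\<^sup>2"
    using assms sxy by (intro power_mono) auto
  have "?d = sxx * syy * sxy\<^sup>2 + sxy\<^sup>2 * sxy\<^sup>2"
    by (simp add: power4_eq_xxxx power2_eq_square)
  also have "\<dots> \<le> \<rho> * \<rho> * (2 * h)\<^sup>2 + (2 * h)\<^sup>2 * (2 * h)\<^sup>2"
    using assms sq \<rho> by (intro add_mono mult_mono) auto
  also have "\<dots> \<le> (2 * h * \<rho> + 4 * h\<^sup>2)\<^sup>2"
    using assms \<rho> by (simp add: power2_eq_square algebra_simps)
  finally have d: "sqrt ?d \<le> 2 * h * \<rho> + 4 * h\<^sup>2"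
    using assms \<rho> by (intro real_le_lsqrt) auto
  have "0 \<le> C * (2 * h * \<rho> + 4 * h\<^sup>2)"
    using assms \<rho> by simp
  then have "0 < q * (g / 2)" using q by linarith
  then have qpos: "0 < q" using assms by (simp add: zero_less_mult_iff)
  have "C * sqrt ?d \<le> C * (2 * h * \<rho> + 4 * h\<^sup>2)"
    using d assms by simp
  also have "\<dots> < q * (g / 2)" by (rule q)
  also have "\<dots> < q * \<theta>" using assms qpos by simp
  finally show ?thesis
    using pos by (simp add: field_simps)
qed

lemma splits_subsample:
  assumes "s \<in> splits k" "l \<in> {1..4}"
  shows "finite (subsample k s l)" "card (subsample k s l) = k" "subsample k s l \<subseteq> {..<4 * k}"
  using assms by (auto simp: splits_def subsample_def)

lemma subsample_disjoint: "l \<noteq> l' \<Longrightarrow> subsample k s l \<inter> subsample k s l' = {}"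
  by (auto simp: subsample_def)

lemma measurable_test_stat:
  assumes X: "\<And>i. i < 4 * m \<Longrightarrow> X i \<in> F \<rightarrow>\<^sub>M borel_vec p" and Y: "\<And>i. i < 4 * n \<Longrightarrow> Y i \<in> F \<rightarrow>\<^sub>M borel_vec p"
  shows "(\<lambda>x. test_stat p m n (\<lambda>i. X i x) (\<lambda>i. Y i x) s t) \<in> borel_measurable F"
    and "(\<lambda>x. mat_trace (sample_cov p (4 * m) (\<lambda>i. X i x) * sample_cov p (4 * n) (\<lambda>i. Y i x))) \<in> borel_measurable F"
    and "(\<lambda>x. mat_trace (scatter p (subsample m s a) (\<lambda>i. X i x) * scatter p (subsample m s b) (\<lambda>i. X i x)
            * scatter p (subsample n t c) (\<lambda>i. Y i x) * scatter p (subsample n t d) (\<lambda>i. Y i x))) \<in> borel_measurable F"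
    and "(\<lambda>x. mat_trace (scatter p (subsample m s a) (\<lambda>i. X i x) * scatter p (subsample n t c) (\<lambda>i. Y i x)
            * scatter p (subsample m s b) (\<lambda>i. X i x) * scatter p (subsample n t d) (\<lambda>i. Y i x))) \<in> borel_measurable F"
    and "(\<lambda>x. sigma_hat_sq p (4 * m) (sample_cov p (4 * m) (\<lambda>i. X i x))) \<in> borel_measurable F"
    and "(\<lambda>x. sigma_hat_sq p (4 * n) (sample_cov p (4 * n) (\<lambda>i. Y i x))) \<in> borel_measurable F"
proof -
  \<comment> \<open>\<open>rmat_scatter\<close> is about scaled matrices; the factor 1 adapts it to
    the bare ones.\<close>
  have one: "1 \<cdot>\<^sub>m A = A" for A :: "real mat"
    by (rule eq_matI) auto
  have Tx: "rmat p F (\<lambda>x. scatter p (subsample m s l) (\<lambda>i. X i x))" for l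
    using rmat_scatter[of "subsample m s l" X F p 1] X by (auto simp: one subsample_def)
  have Ty: "rmat p F (\<lambda>x. scatter p (subsample n t l) (\<lambda>i. Y i x))" for l
    using rmat_scatter[of "subsample n t l" Y F p 1] Y by (auto simp: one subsample_def)
  have Sx: "rmat p F (\<lambda>x. sample_cov p (4 * m) (\<lambda>i. X i x))"
    unfolding sample_cov_def using X by (intro rmat_scatter) auto
  have Sy: "rmat p F (\<lambda>x. sample_cov p (4 * n) (\<lambda>i. Y i x))"
    unfolding sample_cov_def using Y by (intro rmat_scatter) auto
  note rules = rmat_trace[of p] rmat_mult Tx Ty Sx Sy
  show 1 [measurable]: "(\<lambda>x. mat_trace (sample_cov p (4 * m) (\<lambda>i. X i x) * sample_cov p (4 * n) (\<lambda>i. Y i x))) \<in> borel_measurable F"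
    by (intro rules)
  show 2 [measurable]: "(\<lambda>x. mat_trace (scatter p (subsample m s a) (\<lambda>i. X i x) * scatter p (subsample m s b) (\<lambda>i. X i x)
            * scatter p (subsample n t c) (\<lambda>i. Y i x) * scatter p (subsample n t d) (\<lambda>i. Y i x))) \<in> borel_measurable F" for a b c d
    by (intro rules)
  show 3 [measurable]: "(\<lambda>x. mat_trace (scatter p (subsample m s a) (\<lambda>i. X i x) * scatter p (subsample n t c) (\<lambda>i. Y i x)
            * scatter p (subsample m s b) (\<lambda>i. X i x) * scatter p (subsample n t d) (\<lambda>i. Y i x))) \<in> borel_measurable F" for a b c d
    by (intro rules)
  have [measurable]: "(\<lambda>x. mat_trace (sample_cov p (4 * m) (\<lambda>i. X i x) * sample_cov p (4 * m) (\<lambda>i. X i x))) \<in> borel_measurable F"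
    "(\<lambda>x. mat_trace (sample_cov p (4 * n) (\<lambda>i. Y i x) * sample_cov p (4 * n) (\<lambda>i. Y i x))) \<in> borel_measurable F"
    "(\<lambda>x. mat_trace (sample_cov p (4 * m) (\<lambda>i. X i x))) \<in> borel_measurable F"
    "(\<lambda>x. mat_trace (sample_cov p (4 * n) (\<lambda>i. Y i x))) \<in> borel_measurable F"
    by (intro rules)+
  show 4 [measurable]: "(\<lambda>x. sigma_hat_sq p (4 * m) (sample_cov p (4 * m) (\<lambda>i. X i x))) \<in> borel_measurable F"
    "(\<lambda>x. sigma_hat_sq p (4 * n) (sample_cov p (4 * n) (\<lambda>i. Y i x))) \<in> borel_measurable F"
    unfolding sigma_hat_sq_def by measurable
  show "(\<lambda>x. test_stat p m n (\<lambda>i. X i x) (\<lambda>i. Y i x) s t) \<in> borel_measurable F"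
    unfolding test_stat_def Let_def theta_hat_def sigma_hat_xy_def by measurable
qed

text \<open>Failure of the test forces one of five events: a large deviation of one of the three
  traces, or a large value of one of the two variance estimators. The former are controlled by
  second moments, the latter by their means, which are at most \<open>K\<close>. The bound does not
  involve \<open>s\<close> and \<open>t\<close>.\<close>

lemma (in prob_space) prob_test_stat_le:
  fixes X Y :: "nat \<Rightarrow> 'a \<Rightarrow> real vec"
  assumes normal_X: "\<And>i. i < 4 * m \<Longrightarrow> mv_normal M p \<mu>x \<Sigma>x (X i)"
    and normal_Y: "\<And>i. i < 4 * n \<Longrightarrow> mv_normal M p \<mu>y \<Sigma>y (Y i)"
    and ind: "indep_vars (\<lambda>_. borel_vec p) (case_sum X Y) ({..<4 * m} <+> {..<4 * n})"
    and \<mu>: "\<mu>x \<in> carrier_vec p" "\<mu>y \<in> carrier_vec p"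
    and \<Sigma>: "pos_def p \<Sigma>x" "pos_def p \<Sigma>y"
    and st: "s \<in> splits m" "t \<in> splits n"
    and p: "1 \<le> p" and mn: "2 \<le> m" "2 \<le> n"
    and \<kappa>: "1 / (real m - 1) \<le> \<kappa>" "1 / (real n - 1) \<le> \<kappa>" "\<kappa> \<le> 1"
    and K: "0 \<le> K" "\<And>w. 2 \<le> length w \<Longrightarrow> length w \<le> 8 \<Longrightarrow> mat_trace (word_prod p \<Sigma>x \<Sigma>y w) / real p \<le> K"
    and gap: "3 * g / 4 < mat_trace (word_prod p \<Sigma>x \<Sigma>y [PX, PX, PY, PY]) / real p
      - mat_trace (word_prod p \<Sigma>x \<Sigma>y [PX, PY, PX, PY]) / real p"
    and h: "\<bar>mat_trace (word_prod p \<Sigma>x \<Sigma>y [PX, PY]) / real p - h\<bar> < h / 4"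
    and pos: "0 < g" "0 < h" "0 < \<rho>" "0 < C"
    and C: "C * (2 * h * \<rho> + 4 * h\<^sup>2) < (real m - 1) * (real n - 1) / real p * (g / 2)"
  defines "b \<equiv> \<kappa> * (K * real p) * (2 + \<kappa> * (K * real p)) ^ 3 / (real p)\<^sup>2"
  shows "prob {x\<in>space M. \<not> C < test_stat p m n (\<lambda>i. X i x) (\<lambda>i. Y i x) s t}
    \<le> 4096 * b / (g / 8)\<^sup>2 + 4096 * b / (g / 8)\<^sup>2 + 64 * b / (h / 4)\<^sup>2 + K / \<rho> + K / \<rho>"
proof -
  let ?I = "{..<4 * m} <+> {..<4 * n}"
  let ?F = "block_algebra M (\<lambda>_. borel_vec p) (case_sum X Y)"
  let ?S = "case_population \<Sigma>x \<Sigma>y"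
  have tpx: "trace_pos p \<Sigma>x" and tpy: "trace_pos p \<Sigma>y"
    using trace_pos_covariance[OF normal_X[of 0] \<mu>(1) \<Sigma>(1)] trace_pos_covariance[OF normal_Y[of 0] \<mu>(2) \<Sigma>(2)] mn by auto
  have \<kappa>0: "0 \<le> \<kappa>"
    using \<kappa>(1) mn by (intro order_trans[OF _ \<kappa>(1)]) auto
  interpret W: wishart_words M p ?S \<kappa> "K * real p" ?I ?F
  proof
    show "trace_pos p (?S i)" "psd p (?S i)" for i
      using tpx tpy pos_def_imp_psd \<Sigma> by (auto split: population.split)
    show "mat_trace (word_prod p (?S PX) (?S PY) w) \<le> K * real p" if "2 \<le> length w" "length w \<le> 8" for w
      using K(2)[OF that] p by (simp add: field_simps)
  qed (use \<kappa> \<kappa>0 K p block_algebra_indep[OF ind] block_algebra_mono[OF ind] in auto)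
  have indX: "indep_vars (\<lambda>_. borel_vec p) X J" if "J \<subseteq> {..<4 * m}" for J
    using indep_vars_reindex[OF indep_vars_subset[OF ind, of "Inl ` J"]] that by auto
  have indY: "indep_vars (\<lambda>_. borel_vec p) Y J" if "J \<subseteq> {..<4 * n}" for J
    using indep_vars_reindex[OF indep_vars_subset[OF ind, of "Inr ` J"]] that by auto
  \<comment> \<open>Allowing any size \<open>k\<close> of at least \<open>m\<close> covers the
    subsamples and the whole sample at once; a larger sample has a smaller covariance
    parameter.\<close>
  have obsX: "W.observed PX (Inl ` J) (\<lambda>x. (1 / (real k - 1)) \<cdot>\<^sub>m scatter p J (\<lambda>i. X i x))"
    if J: "J \<subseteq> {..<4 * m}" "card J = k" "m \<le> k" for J k
  proof -
    have fin: "finite J" using J(1) by (rule finite_subset) simp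
    have "wishart_moments p \<Sigma>x (1 / (real k - 1)) (\<lambda>x. (1 / (real k - 1)) \<cdot>\<^sub>m scatter p J (\<lambda>i. X i x))"
      using wishart_moments_scatter[OF fin _ indX[OF J(1)] normal_X \<mu>(1) \<Sigma>(1)] J mn by auto
    moreover have "rmat p (?F (Inl ` J)) (\<lambda>x. (1 / (real k - 1)) \<cdot>\<^sub>m scatter p J (\<lambda>i. X i x))"
      using block_algebra_component[OF ind, of "Inl ` J" "Inl i" for i] J(1) by (intro rmat_scatter) auto
    moreover have "1 / (real k - 1) \<le> \<kappa>"
      using J mn by (intro order_trans[OF _ \<kappa>(1)] divide_left_mono) auto
    ultimately show ?thesis
      using J mn unfolding W.observed_def by (auto intro!: exI[of _ "1 / (real k - 1)"])
  qed
  have obsY: "W.observed PY (Inr ` J) (\<lambda>x. (1 / (real k - 1)) \<cdot>\<^sub>m scatter p J (\<lambda>i. Y i x))"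
    if J: "J \<subseteq> {..<4 * n}" "card J = k" "n \<le> k" for J k
  proof -
    have fin: "finite J" using J(1) by (rule finite_subset) simp
    have "wishart_moments p \<Sigma>y (1 / (real k - 1)) (\<lambda>x. (1 / (real k - 1)) \<cdot>\<^sub>m scatter p J (\<lambda>i. Y i x))"
      using wishart_moments_scatter[OF fin _ indY[OF J(1)] normal_Y \<mu>(2) \<Sigma>(2)] J mn by auto
    moreover have "rmat p (?F (Inr ` J)) (\<lambda>x. (1 / (real k - 1)) \<cdot>\<^sub>m scatter p J (\<lambda>i. Y i x))"
      using block_algebra_component[OF ind, of "Inr ` J" "Inr i" for i] J(1) by (intro rmat_scatter) auto
    moreover have "1 / (real k - 1) \<le> \<kappa>"
      using J mn by (intro order_trans[OF _ \<kappa>(2)] divide_left_mono) auto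
    ultimately show ?thesis
      using J mn unfolding W.observed_def by (auto intro!: exI[of _ "1 / (real k - 1)"])
  qed
  define Ax where "Ax l x = (1 / (real m - 1)) \<cdot>\<^sub>m scatter p (subsample m s l) (\<lambda>i. X i x)" for l x
  define Ay where "Ay l x = (1 / (real n - 1)) \<cdot>\<^sub>m scatter p (subsample n t l) (\<lambda>i. Y i x)" for l x
  define Sx where "Sx x = sample_cov p (4 * m) (\<lambda>i. X i x)" for x
  define Sy where "Sy x = sample_cov p (4 * n) (\<lambda>i. Y i x)" for x
  let ?Jx = "\<lambda>l. Inl ` subsample m s l :: (nat + nat) set" and ?Jy = "\<lambda>l. Inr ` subsample n t l :: (nat + nat) set"
  have oAx: "W.observed PX (?Jx l) (Ax l)" if "l \<in> {1..4}" for l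
    unfolding Ax_def using splits_subsample[OF st(1) that] by (intro obsX) auto
  have oAy: "W.observed PY (?Jy l) (Ay l)" if "l \<in> {1..4}" for l
    unfolding Ay_def using splits_subsample[OF st(2) that] by (intro obsY) auto
  have oSx: "W.observed PX (Inl ` {..<4 * m}) Sx" and oSy: "W.observed PY (Inr ` {..<4 * n}) Sy"
    unfolding Sx_def Sy_def sample_cov_def by (intro obsX obsY; simp)+
  have c: "Ax l x \<in> carrier_mat p p" "Ay l x \<in> carrier_mat p p" "Sx x \<in> carrier_mat p p" "Sy x \<in> carrier_mat p p" for l x
    by (simp_all add: Ax_def Ay_def Sx_def Sy_def sample_cov_def)
  have dX: "?Jx l \<inter> ?Jx l' = {}" "?Jy l \<inter> ?Jy l' = {}" if "l \<noteq> l'" for l l'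
    using subsample_disjoint[OF that] by auto
  have dXY: "Inl ` A \<inter> Inr ` B = {}" "Inr ` B \<inter> Inl ` A = {}" for A B :: "nat set"
    by auto
  define \<alpha> where "\<alpha> w = mat_trace (word_prod p \<Sigma>x \<Sigma>y w)" for w
  define t1 where "t1 x = mat_trace (Ax 1 x * (Ax 2 x * (Ay 1 x * Ay 2 x)))" for x
  define t2 where "t2 x = mat_trace (Ax 3 x * (Ay 3 x * (Ax 4 x * Ay 4 x)))" for x
  define t3 where "t3 x = mat_trace (Sx x * Sy x)" for x
  let ?B = "\<kappa> * (K * real p) * (2 + \<kappa> * (K * real p)) ^ 3"
  have B: "0 \<le> ?B" using \<kappa>0 K by simp
  note ones = left_mult_one_mat[of _ p p] right_mult_one_mat[of _ p p] mult_carrier_mat[of _ p p _ p]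
  \<comment> \<open>The constant is 8^4 for four factors, and \<open>q\<close> is 3 because three
    factors remain beside the centred one.\<close>
  have I1: "(\<integral>\<^sup>+x. ennreal ((t1 x - \<alpha> [PX, PX, PY, PY])\<^sup>2) \<partial>M) \<le> ennreal (4096 * ?B)"
    using W.nn_integral_trace_deviation_le[of "[(PX, ?Jx 1, Ax 1), (PX, ?Jx 2, Ax 2), (PY, ?Jy 1, Ay 1), (PY, ?Jy 2, Ay 2)]" "[]" 3]
      oAx oAy dX dXY by (simp add: t1_def \<alpha>_def W.R_def ones c Int_Un_distrib)
  have I2: "(\<integral>\<^sup>+x. ennreal ((t2 x - \<alpha> [PX, PY, PX, PY])\<^sup>2) \<partial>M) \<le> ennreal (4096 * ?B)"
    using W.nn_integral_trace_deviation_le[of "[(PX, ?Jx 3, Ax 3), (PY, ?Jy 3, Ay 3), (PX, ?Jx 4, Ax 4), (PY, ?Jy 4, Ay 4)]" "[]" 3]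
      oAx oAy dX dXY by (simp add: t2_def \<alpha>_def W.R_def ones c Int_Un_distrib)
  \<comment> \<open>Two factors give 8^2. The exponent 3 is kept although 1 would do, so that all
    three traces are bounded by multiples of the same \<open>?B\<close>.\<close>
  have I3: "(\<integral>\<^sup>+x. ennreal ((t3 x - \<alpha> [PX, PY])\<^sup>2) \<partial>M) \<le> ennreal (64 * ?B)"
    using W.nn_integral_trace_deviation_le[of "[(PX, Inl ` {..<4 * m}, Sx), (PY, Inr ` {..<4 * n}, Sy)]" "[]" 3]
      oSx oSy dXY by (simp add: t3_def \<alpha>_def W.R_def ones c)
  have rvX: "X i \<in> M \<rightarrow>\<^sub>M borel_vec p" if "i < 4 * m" for i
    using normal_X[OF that] by (simp add: mv_normal_def)
  have rvY: "Y i \<in> M \<rightarrow>\<^sub>M borel_vec p" if "i < 4 * n" for i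
    using normal_Y[OF that] by (simp add: mv_normal_def)
  note meas = measurable_test_stat[of m X M p n Y, OF rvX rvY]
  have t1: "t1 x = mat_trace (scatter p (subsample m s 1) (\<lambda>i. X i x) * scatter p (subsample m s 2) (\<lambda>i. X i x)
            * scatter p (subsample n t 1) (\<lambda>i. Y i x) * scatter p (subsample n t 2) (\<lambda>i. Y i x)) / ((real m - 1)\<^sup>2 * (real n - 1)\<^sup>2)" for x
    unfolding t1_def Ax_def Ay_def by (subst mat_trace_smult4[of _ p]) (simp_all add: power2_eq_square)
  have t2: "t2 x = mat_trace (scatter p (subsample m s 3) (\<lambda>i. X i x) * scatter p (subsample n t 3) (\<lambda>i. Y i x)
            * scatter p (subsample m s 4) (\<lambda>i. X i x) * scatter p (subsample n t 4) (\<lambda>i. Y i x)) / ((real m - 1)\<^sup>2 * (real n - 1)\<^sup>2)" for x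
    unfolding t2_def Ax_def Ay_def by (subst mat_trace_smult4[of _ p]) (simp_all add: power2_eq_square)
  have [measurable]: "t1 \<in> borel_measurable M" "t2 \<in> borel_measurable M"
    unfolding t1 t2 using meas by auto
  have [measurable]: "t3 \<in> borel_measurable M"
    unfolding t3_def Sx_def Sy_def using meas by auto
  define u where "u x = sigma_hat_sq p (4 * m) (Sx x)" for x
  define v where "v x = sigma_hat_sq p (4 * n) (Sy x)" for x
  have [measurable]: "u \<in> borel_measurable M" "v \<in> borel_measurable M"
    unfolding u_def v_def Sx_def Sy_def using meas by auto
  have uv0: "0 \<le> u x" "0 \<le> v x" for x
    unfolding u_def v_def Sx_def Sy_def using mn by (auto intro!: sigma_hat_sq_nonneg)
  have wx: "wishart_moments p \<Sigma>x (1 / (real (4 * m) - 1)) Sx"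
    unfolding Sx_def sample_cov_def
    using wishart_moments_scatter[OF _ _ indX[OF order_refl] normal_X \<mu>(1) \<Sigma>(1)] mn by auto
  have wy: "wishart_moments p \<Sigma>y (1 / (real (4 * n) - 1)) Sy"
    unfolding Sy_def sample_cov_def
    using wishart_moments_scatter[OF _ _ indY[OF order_refl] normal_Y \<mu>(2) \<Sigma>(2)] mn by auto
  have Iu: "(\<integral>\<^sup>+x. ennreal (u x) \<partial>M) \<le> ennreal K"
    using sigma_hat_sq_unbiased[OF wx] mn K(2)[of "[PX, PX]"] uv0 \<Sigma>(1)
    by (subst nn_integral_eq_integral) (auto simp: has_bochner_integral_iff u_def[abs_def] ones pos_def_def intro!: ennreal_leI)
  have Iv: "(\<integral>\<^sup>+x. ennreal (v x) \<partial>M) \<le> ennreal K"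
    using sigma_hat_sq_unbiased[OF wy] mn K(2)[of "[PY, PY]"] uv0 \<Sigma>(2)
    by (subst nn_integral_eq_integral) (auto simp: has_bochner_integral_iff v_def[abs_def] ones pos_def_def intro!: ennreal_leI)
  \<comment> \<open>Outside \<open>E1\<close> and \<open>E2\<close> the two errors take at most g/4
    from the gap 3g/4 and leave g/2. Outside \<open>E3\<close> the error h/4, added to the distance
    h/4 of the mean from \<open>h\<close>, keeps the cross estimator above h/2.\<close>
  define E1 where "E1 = {x\<in>space M. g / 8 * real p \<le> \<bar>t1 x - \<alpha> [PX, PX, PY, PY]\<bar>}"
  define E2 where "E2 = {x\<in>space M. g / 8 * real p \<le> \<bar>t2 x - \<alpha> [PX, PY, PX, PY]\<bar>}"
  define E3 where "E3 = {x\<in>space M. h / 4 * real p \<le> \<bar>t3 x - \<alpha> [PX, PY]\<bar>}"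
  define E4 where "E4 = {x\<in>space M. \<rho> \<le> u x}"
  define E5 where "E5 = {x\<in>space M. \<rho> \<le> v x}"
  have [measurable]: "E1 \<in> events" "E2 \<in> events" "E3 \<in> events" "E4 \<in> events" "E5 \<in> events"
    unfolding E1_def E2_def E3_def E4_def E5_def by measurable
  have scale_b: "c * ?B / (r * real p)\<^sup>2 = c * b / r\<^sup>2" for c r
    by (simp add: b_def power_mult_distrib mult_ac)
  have P1: "prob E1 \<le> 4096 * b / (g / 8)\<^sup>2"
    unfolding E1_def scale_b[symmetric] by (rule prob_abs_ge_le[OF _ I1]) (use B pos p in auto)
  have P2: "prob E2 \<le> 4096 * b / (g / 8)\<^sup>2"
    unfolding E2_def scale_b[symmetric] by (rule prob_abs_ge_le[OF _ I2]) (use B pos p in auto)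
  have P3: "prob E3 \<le> 64 * b / (h / 4)\<^sup>2"
    unfolding E3_def scale_b[symmetric] by (rule prob_abs_ge_le[OF _ I3]) (use B pos p in auto)
  have P4: "prob E4 \<le> K / \<rho>"
    unfolding E4_def by (rule prob_ge_le[OF _ Iu]) (use K pos in auto)
  have P5: "prob E5 \<le> K / \<rho>"
    unfolding E5_def by (rule prob_ge_le[OF _ Iv]) (use K pos in auto)
  have sub: "{x\<in>space M. \<not> C < test_stat p m n (\<lambda>i. X i x) (\<lambda>i. Y i x) s t} \<subseteq> E1 \<union> E2 \<union> E3 \<union> E4 \<union> E5"
  proof (rule subsetI, rule ccontr)
    fix x assume x: "x \<in> {x\<in>space M. \<not> C < test_stat p m n (\<lambda>i. X i x) (\<lambda>i. Y i x) s t}"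
      and "x \<notin> E1 \<union> E2 \<union> E3 \<union> E4 \<union> E5"
    then have e: "\<bar>t1 x - \<alpha> [PX, PX, PY, PY]\<bar> < g / 8 * real p" "\<bar>t2 x - \<alpha> [PX, PY, PX, PY]\<bar> < g / 8 * real p"
      "\<bar>t3 x - \<alpha> [PX, PY]\<bar> < h / 4 * real p" "u x < \<rho>" "v x < \<rho>"
      by (auto simp: E1_def E2_def E3_def E4_def E5_def not_le)
    have pp: "0 < real p" using p by simp
    have scale: "\<bar>y / real p - z / real p\<bar> < r" if "\<bar>y - z\<bar> < r * real p" for y z r
      using that pp by (simp add: diff_divide_distrib[symmetric] field_simps)
    have \<theta>: "theta_hat p m n (\<lambda>l. scatter p (subsample m s l) (\<lambda>i. X i x)) (\<lambda>l. scatter p (subsample n t l) (\<lambda>i. Y i x))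
        = t1 x / real p - t2 x / real p"
      using mn pp by (simp add: theta_hat_def t1 t2 field_simps)
    have "C < (real m - 1) * (real n - 1) / real p * ((t1 x / real p - t2 x / real p)
        / sqrt (u x * v x * (t3 x / real p)\<^sup>2 + (t3 x / real p) ^ 4))"
    proof (rule test_stat_gt[OF _ uv0(1) _ uv0(2)])
      show "g / 2 < t1 x / real p - t2 x / real p"
        using scale[OF e(1)] scale[OF e(2)] gap unfolding \<alpha>_def by linarith
      show "h / 2 < t3 x / real p" "t3 x / real p < 2 * h"
        using scale[OF e(3)] h pos unfolding \<alpha>_def by linarith+
      show "u x \<le> \<rho>" "v x \<le> \<rho>" using e by auto
    qed (use pos C in auto)
    then have "C < test_stat p m n (\<lambda>i. X i x) (\<lambda>i. Y i x) s t"
      unfolding test_stat_def Let_def \<theta> sigma_hat_xy_def by (simp only: t3_def u_def v_def Sx_def Sy_def)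
    then show False using x by simp
  qed
  have "prob {x\<in>space M. \<not> C < test_stat p m n (\<lambda>i. X i x) (\<lambda>i. Y i x) s t} \<le> prob (E1 \<union> E2 \<union> E3 \<union> E4 \<union> E5)"
    by (intro finite_measure_mono sub) measurable
  also have "\<dots> \<le> prob E1 + prob E2 + prob E3 + prob E4 + prob E5"
    using measure_Un_le[of E1 M E2] measure_Un_le[of "E1 \<union> E2" M E3]
      measure_Un_le[of "E1 \<union> E2 \<union> E3" M E4] measure_Un_le[of "E1 \<union> E2 \<union> E3 \<union> E4" M E5]
    by simp
  finally show ?thesis
    using P1 P2 P3 P4 P5 by linarith
qed

section \<open>Random splits and the limit\<close>

text \<open>The event is cut along the finitely many values of the split. On each piece the
  statistic depends on the data alone, so independence factors the probability and the bound for a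
  fixed split applies; the probabilities of the pieces sum to 1.\<close>

lemma prob_random_split_ge:
  fixes P :: "'w measure"
  assumes data: "split_normal_samples P p m n \<mu>x \<Sigma>x \<mu>y \<Sigma>y X Y s t"
    and q: "\<And>s' t'. s' \<in> splits m \<Longrightarrow> t' \<in> splits n \<Longrightarrow>
      measure P {x\<in>space P. \<not> C < test_stat p m n (\<lambda>i. X i x) (\<lambda>i. Y i x) s' t'} \<le> q"
  shows "1 - q \<le> measure P {x\<in>space P. C < test_stat p m n (\<lambda>i. X i x) (\<lambda>i. Y i x) (s x) (t x)}"
proof -
  interpret prob_space P
    using data by (simp add: split_normal_samples_def)
  let ?I = "{..<4 * m} <+> {..<4 * n}" and ?SP = "splits m \<times> splits n"
  let ?N = "\<lambda>_ :: nat + nat. borel_vec p" and ?D = "case_sum X Y"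
  let ?U = "\<lambda>x. (s x, t x)"
  have ind: "indep_vars ?N ?D ?I"
    and U: "?U \<in> P \<rightarrow>\<^sub>M count_space ?SP"
    and iset: "indep_set {?U -` A \<inter> space P | A. A \<subseteq> ?SP}
        {(\<lambda>x. \<lambda>i\<in>?I. ?D i x) -` B \<inter> space P | B. B \<in> sets (PiM ?I ?N)}"
    using data by (simp_all add: split_normal_samples_def)
  have comp: "X i \<in> block_algebra P ?N ?D ?I \<rightarrow>\<^sub>M borel_vec p" if "i < 4 * m" for i
    using block_algebra_component[OF ind order_refl, of "Inl i"] that by auto
  have comp': "Y i \<in> block_algebra P ?N ?D ?I \<rightarrow>\<^sub>M borel_vec p" if "i < 4 * n" for i
    using block_algebra_component[OF ind order_refl, of "Inr i"] that by auto
  define T where "T st x = test_stat p m n (\<lambda>i. X i x) (\<lambda>i. Y i x) (fst st) (snd st)" for st x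
  \<comment> \<open>Measurability with respect to the data alone, rather than \<open>P\<close>,
    places the event among the preimages to which the independence hypothesis refers.\<close>
  have T_meas: "T st \<in> borel_measurable (block_algebra P ?N ?D ?I)" for st
    unfolding T_def using comp comp' by (rule measurable_test_stat(1))
  define E where "E st = {x\<in>space P. C < T st x}" for st
  define Q where "Q st = ?U -` {st} \<inter> space P" for st
  have E_data: "E st \<in> {(\<lambda>x. \<lambda>i\<in>?I. ?D i x) -` B \<inter> space P | B. B \<in> sets (PiM ?I ?N)}" for st
  proof -
    have "{x\<in>space (block_algebra P ?N ?D ?I). C < T st x} \<in> sets (block_algebra P ?N ?D ?I)"
      using T_meas by measurable
    then show ?thesis
      unfolding E_def sets_block_algebra[OF ind order_refl, symmetric] by (simp add: block_algebra_def)
  qed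
  have E_ev: "E st \<in> events" for st
    using E_data[of st] iset unfolding indep_sets2_eq by blast
  have Q_ev: "Q st \<in> events" if "st \<in> ?SP" for st
    unfolding Q_def using U that by (auto intro: measurable_sets)
  have fin: "finite ?SP"
  proof -
    have "finite (splits k)" for k
      by (rule finite_subset[of _ "{..<4 * k} \<rightarrow>\<^sub>E {1..4}"]) (auto simp: splits_def intro!: finite_PiE)
    then show ?thesis by simp
  qed
  have U_SP: "?U x \<in> ?SP" if "x \<in> space P" for x
    using measurable_space[OF U that] by simp
  have disj: "disjoint_family_on Q ?SP" "disjoint_family_on (\<lambda>st. Q st \<inter> E st) ?SP"
    by (auto simp: disjoint_family_on_def Q_def)
  have "(\<Sum>st\<in>?SP. prob (Q st)) = prob (\<Union>st\<in>?SP. Q st)"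
    using fin Q_ev disj by (intro finite_measure_finite_Union[symmetric]) auto
  also have "(\<Union>st\<in>?SP. Q st) = space P"
    using U_SP by (auto simp: Q_def)
  finally have Q1: "(\<Sum>st\<in>?SP. prob (Q st)) = 1"
    by (simp add: prob_space)
  have E_ge: "1 - q \<le> prob (E st)" if "st \<in> ?SP" for st
  proof -
    have "{x\<in>space P. \<not> C < T st x} = space P - E st"
      by (auto simp: E_def)
    then show ?thesis
      using q[of "fst st" "snd st"] that prob_compl[OF E_ev[of st]] by (auto simp: T_def)
  qed
  have "1 - q = (\<Sum>st\<in>?SP. prob (Q st) * (1 - q))"
    by (simp add: sum_distrib_right[symmetric] Q1)
  also have "\<dots> \<le> (\<Sum>st\<in>?SP. prob (Q st \<inter> E st))"
  proof (rule sum_mono)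
    fix st assume st: "st \<in> ?SP"
    have "prob (Q st \<inter> E st) = prob (Q st) * prob (E st)"
      by (rule indep_setD[OF iset _ E_data]) (use st in \<open>auto simp: Q_def\<close>)
    then show "prob (Q st) * (1 - q) \<le> prob (Q st \<inter> E st)"
      using E_ge[OF st] by (simp add: mult_left_mono)
  qed
  also have "\<dots> = prob (\<Union>st\<in>?SP. Q st \<inter> E st)"
    using fin Q_ev E_ev disj by (intro finite_measure_finite_Union[symmetric]) auto
  also have "(\<Union>st\<in>?SP. Q st \<inter> E st) = {x\<in>space P. C < test_stat p m n (\<lambda>i. X i x) (\<lambda>i. Y i x) (s x) (t x)}"
    using U_SP by (auto simp: Q_def E_def T_def)
  finally show ?thesis .
qed

text \<open>As \<delta> < 1, the product of order p^(1 - \<delta>) dominates the 2 in the bracket,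
  so the quotient is of order p^(4 (1 - \<delta>) - 2).\<close>

lemma tendsto_variance_bound:
  fixes d K \<delta> :: real
  assumes "1 / 2 < \<delta>" "\<delta> < 1" "0 < d" "0 < K"
  shows "(\<lambda>p::nat. (d * real p powr - \<delta>) * (K * real p) * (2 + (d * real p powr - \<delta>) * (K * real p)) ^ 3 / (real p)\<^sup>2) \<longlonglongrightarrow> 0"
  using assms by real_asymp

text \<open>The exponent on the right is twice the one on the left, and both are positive.\<close>

lemma eventually_threshold:
  fixes a b c \<delta> :: real
  assumes "1 / 2 < \<delta>" "0 < c"
  shows "\<forall>\<^sub>F p :: nat in sequentially. a * (b * real p powr (\<delta> - 1 / 2) + b\<^sup>2) < c * real p powr (2 * \<delta> - 1)"
  using assms by real_asymp

theorem corollary3p3: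
  fixes P :: "nat \<Rightarrow> 'w measure"
    and m n :: "nat \<Rightarrow> nat"
    and \<delta> C :: real
    and \<mu>x \<mu>y :: "nat \<Rightarrow> real vec"
    and \<Sigma>x \<Sigma>y :: "nat \<Rightarrow> real mat"
    and X Y :: "nat \<Rightarrow> nat \<Rightarrow> 'w \<Rightarrow> real vec"
    and s t :: "nat \<Rightarrow> 'w \<Rightarrow> nat \<Rightarrow> nat"
    and \<sigma> :: "population list \<Rightarrow> real"
  assumes sizes: "\<And>p. p \<ge> 1 \<Longrightarrow> m p \<ge> 1 \<and> n p \<ge> 1"
    and means: "\<And>p. p \<ge> 1 \<Longrightarrow> \<mu>x p \<in> carrier_vec p \<and> \<mu>y p \<in> carrier_vec p"
    and covs: "\<And>p. p \<ge> 1 \<Longrightarrow> pos_def p (\<Sigma>x p) \<and> pos_def p (\<Sigma>y p)"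
    and data: "\<And>p. p \<ge> 1 \<Longrightarrow>
      split_normal_samples (P p) p (m p) (n p) (\<mu>x p) (\<Sigma>x p) (\<mu>y p) (\<Sigma>y p)
        (X p) (Y p) (s p) (t p)"
    and delta: "1 / 2 < \<delta>" "\<delta> < 1"
    and m_order: "(\<lambda>p. real (m p)) \<in> \<Theta>(\<lambda>p. real p powr \<delta>)"
    and n_order: "(\<lambda>p. real (n p)) \<in> \<Theta>(\<lambda>p. real p powr \<delta>)"
    and moments: "moment_assumption \<Sigma>x \<Sigma>y \<sigma>"
    and H1: "\<forall>\<^sub>F p in sequentially. \<Sigma>x p * \<Sigma>y p \<noteq> \<Sigma>y p * \<Sigma>x p"
    and gap: "\<sigma> [PX, PX, PY, PY] - \<sigma> [PX, PY, PX, PY] > 0"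
    and C: "C > 0"
  shows "(\<lambda>p. measure (P p) {\<omega> \<in> space (P p).
            test_stat p (m p) (n p) (\<lambda>i. X p i \<omega>) (\<lambda>i. Y p i \<omega>) (s p \<omega>) (t p \<omega>) > C})
         \<longlonglongrightarrow> 1"
proof -
  define \<alpha> where "\<alpha> w p = mat_trace (word_prod p (\<Sigma>x p) (\<Sigma>y p) w) / real p" for w p
  define g where "g = \<sigma> [PX, PX, PY, PY] - \<sigma> [PX, PY, PX, PY]"
  define h where "h = \<sigma> [PX, PY]"
  have lim: "\<alpha> w \<longlonglongrightarrow> \<sigma> w" if "2 \<le> length w" "length w \<le> 16" for w
    using moments that by (simp add: moment_assumption_def \<alpha>_def[abs_def])
  have g: "0 < g" using gap by (simp add: g_def)
  have h: "0 < h" using moments by (simp add: moment_assumption_def h_def)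
  \<comment> \<open>There are finitely many words of length at most 8, so their convergent traces
    are eventually bounded by one constant.\<close>
  define W where "W = {w :: population list. 2 \<le> length w \<and> length w \<le> 8}"
  have "(UNIV :: population set) = {PX, PY}"
    using population.exhaust by auto
  then have "finite (UNIV :: population set)"
    by (metis finite.emptyI finite.insertI)
  then have "finite {w :: population list. set w \<subseteq> UNIV \<and> length w \<le> 8}"
    by (rule finite_lists_length_le)
  then have W: "finite W"
    by (rule finite_subset[rotated]) (auto simp: W_def)
  \<comment> \<open>The summand 1 makes \<open>K\<close> strictly larger than every limit, so the
    normalised traces eventually fall below it.\<close>
  define K where "K = 1 + (\<Sum>w\<in>W. \<bar>\<sigma> w\<bar>)"
  have K: "0 < K"
    unfolding K_def by (intro add_pos_nonneg sum_nonneg) auto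
  have "\<sigma> w < K" if "w \<in> W" for w
    using member_le_sum[OF that, of "\<lambda>w. \<bar>\<sigma> w\<bar>"] W by (simp add: K_def)
  then have ev_K: "\<forall>\<^sub>F p in sequentially. \<forall>w\<in>W. \<alpha> w p < K"
    using W lim by (intro eventually_ball_finite ballI order_tendstoD(2)) (auto simp: W_def)
  have "(\<lambda>p. \<alpha> [PX, PX, PY, PY] p - \<alpha> [PX, PY, PX, PY] p) \<longlonglongrightarrow> g"
    unfolding g_def by (intro tendsto_diff lim) auto
  then have ev_g: "\<forall>\<^sub>F p in sequentially. 3 * g / 4 < \<alpha> [PX, PX, PY, PY] p - \<alpha> [PX, PY, PX, PY] p"
    by (rule order_tendstoD(1)) (use g in simp)
  have ev_h: "\<forall>\<^sub>F p in sequentially. \<bar>\<alpha> [PX, PY] p - h\<bar> < h / 4"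
    using tendstoD[OF lim[of "[PX, PY]"], of "h / 4"] h by (simp add: h_def[symmetric] dist_real_def)
  obtain c1 where c1: "0 < c1" "\<forall>\<^sub>F p in sequentially. norm (real (m p)) \<ge> c1 * norm (real p powr \<delta>)"
    using bigthetaD2[OF m_order] by (rule landau_omega.bigE)
  obtain c2 where c2: "0 < c2" "\<forall>\<^sub>F p in sequentially. norm (real (n p)) \<ge> c2 * norm (real p powr \<delta>)"
    using bigthetaD2[OF n_order] by (rule landau_omega.bigE)
  \<comment> \<open>Halving the constant absorbs the 1 in \<open>m - 1\<close> and
    \<open>n - 1\<close> as soon as \<open>c\<close> p^\<delta> is at least 1.\<close>
  define c where "c = min c1 c2 / 2"
  have c: "0 < c" using c1 c2 by (simp add: c_def)
  have inf: "\<forall>\<^sub>F p in sequentially. 1 \<le> c * real p powr \<delta>"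
    using c delta by real_asymp
  have ev_size: "\<forall>\<^sub>F p in sequentially. c * real p powr \<delta> \<le> real (k p) - 1"
    if k: "0 < c'" "c \<le> c' / 2" "\<forall>\<^sub>F p in sequentially. norm (real (k p)) \<ge> c' * norm (real p powr \<delta>)"
    for c' and k :: "nat \<Rightarrow> nat"
    using k(3) inf
  proof eventually_elim
    case (elim p)
    have "2 * c * real p powr \<delta> \<le> c' * real p powr \<delta>"
      using k(2) by (intro mult_right_mono) auto
    then show ?case using elim by simp
  qed
  have ev_m: "\<forall>\<^sub>F p in sequentially. c * real p powr \<delta> \<le> real (m p) - 1"
    using c1 by (intro ev_size[of c1]) (auto simp: c_def)
  have ev_n: "\<forall>\<^sub>F p in sequentially. c * real p powr \<delta> \<le> real (n p) - 1"
    using c2 by (intro ev_size[of c2]) (auto simp: c_def)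
  \<comment> \<open>The reciprocal of the common lower bound \<open>c\<close> p^\<delta> for both
    degrees of freedom.\<close>
  define \<kappa> where "\<kappa> p = 1 / c * real p powr - \<delta>" for p :: nat
  \<comment> \<open>The exponent is the midpoint between 0 and 2 \<delta> - 1: \<rho> has to diverge
    for Markov's inequality to help, but more slowly than the factor in front of the
    statistic.\<close>
  define \<rho> where "\<rho> p = real p powr (\<delta> - 1 / 2)" for p :: nat
  define b where "b p = \<kappa> p * (K * real p) * (2 + \<kappa> p * (K * real p)) ^ 3 / (real p)\<^sup>2" for p
  define q where "q p = 4096 * b p / (g / 8)\<^sup>2 + 4096 * b p / (g / 8)\<^sup>2 + 64 * b p / (h / 4)\<^sup>2 + K / \<rho> p + K / \<rho> p" for p
  have "b \<longlonglongrightarrow> 0"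
    unfolding b_def \<kappa>_def using tendsto_variance_bound[of \<delta> "1 / c" K] delta c K by simp
  moreover have "(\<lambda>p. K / \<rho> p) \<longlonglongrightarrow> 0"
    unfolding \<rho>_def using delta by real_asymp
  ultimately have "q \<longlonglongrightarrow> 4096 * 0 / (g / 8)\<^sup>2 + 4096 * 0 / (g / 8)\<^sup>2 + 64 * 0 / (h / 4)\<^sup>2 + 0 + 0"
    unfolding q_def using g h by (intro tendsto_intros) auto
  then have "(\<lambda>p. 1 - q p) \<longlonglongrightarrow> 1 - 0"
    by (intro tendsto_diff tendsto_const) simp
  then have lower: "(\<lambda>p. 1 - q p) \<longlonglongrightarrow> 1" by simp
  have ev_C: "\<forall>\<^sub>F p :: nat in sequentially. C * (2 * h * real p powr (\<delta> - 1 / 2) + (2 * h)\<^sup>2)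
      < c\<^sup>2 * (g / 2) * real p powr (2 * \<delta> - 1)"
    using delta c g by (intro eventually_threshold) auto
  let ?prob = "\<lambda>p. measure (P p) {\<omega> \<in> space (P p).
            test_stat p (m p) (n p) (\<lambda>i. X p i \<omega>) (\<lambda>i. Y p i \<omega>) (s p \<omega>) (t p \<omega>) > C}"
  have "\<forall>\<^sub>F p in sequentially. 1 - q p \<le> ?prob p"
    using ev_K ev_g ev_h ev_m ev_n ev_C inf eventually_ge_at_top[of 1]
  proof eventually_elim
    case (elim p)
    have p: "1 \<le> p" by fact
    \<comment> \<open>Both sizes minus 1 are at least \<open>c\<close> p^\<delta>, which is at least
      1 by \<open>inf\<close>.\<close>
    have mn: "2 \<le> m p" "2 \<le> n p" using elim by linarith+
    have pos: "0 < c * real p powr \<delta>" using c p by simp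
    have \<kappa>: "\<kappa> p = 1 / (c * real p powr \<delta>)"
      by (simp add: \<kappa>_def powr_minus field_simps)
    note dat = data[OF p, unfolded split_normal_samples_def]
    interpret prob_space "P p" using dat by simp
    have "measure (P p) {x\<in>space (P p). \<not> C < test_stat p (m p) (n p) (\<lambda>i. X p i x) (\<lambda>i. Y p i x) s' t'} \<le> q p"
      if st: "s' \<in> splits (m p)" "t' \<in> splits (n p)" for s' t'
      unfolding q_def b_def
    proof (rule prob_test_stat_le[where \<mu>x = "\<mu>x p" and \<mu>y = "\<mu>y p" and \<Sigma>x = "\<Sigma>x p" and \<Sigma>y = "\<Sigma>y p"])
      show "1 / (real (m p) - 1) \<le> \<kappa> p" "1 / (real (n p) - 1) \<le> \<kappa> p"
        unfolding \<kappa> using elim pos c by (auto intro!: divide_left_mono mult_pos_pos)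
      show "\<kappa> p \<le> 1"
        unfolding \<kappa> using \<open>1 \<le> c * real p powr \<delta>\<close> pos by simp
      show "mat_trace (word_prod p (\<Sigma>x p) (\<Sigma>y p) w) / real p \<le> K" if "2 \<le> length w" "length w \<le> 8" for w
        using elim(1) that by (auto simp: W_def \<alpha>_def intro: less_imp_le)
      show "C * (2 * h * \<rho> p + 4 * h\<^sup>2) < (real (m p) - 1) * (real (n p) - 1) / real p * (g / 2)"
      proof -
        have "C * (2 * h * \<rho> p + 4 * h\<^sup>2) < c\<^sup>2 * (g / 2) * real p powr (2 * \<delta> - 1)"
          using elim by (simp add: \<rho>_def power2_eq_square)
        also have "\<dots> = (c * real p powr \<delta>) * (c * real p powr \<delta>) / real p * (g / 2)"
        proof -
          have "real p powr (2 * \<delta> - 1) = real p powr \<delta> * real p powr \<delta> / real p"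
            using p by (simp add: powr_diff powr_add[symmetric])
          then show ?thesis by (simp add: power2_eq_square mult_ac)
        qed
        also have "\<dots> \<le> (real (m p) - 1) * (real (n p) - 1) / real p * (g / 2)"
          using elim pos g by (intro mult_right_mono divide_right_mono mult_mono) auto
        finally show ?thesis .
      qed
    qed (use dat means[OF p] covs[OF p] st p mn K elim g h C in \<open>auto simp: \<alpha>_def \<rho>_def\<close>)
    then show ?case
      using prob_random_split_ge[OF data[OF p]] by blast
  qed
  moreover have "\<forall>\<^sub>F p in sequentially. ?prob p \<le> 1"
    using eventually_ge_at_top[of 1]
  proof eventually_elim
    case (elim p)
    then interpret prob_space "P p"
      using data by (simp add: split_normal_samples_def)
    show ?case by (rule prob_le_1)
  qed
  ultimately show ?thesis
    using lower by (intro tendsto_sandwich[OF _ _ lower tendsto_const]) auto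
qed

end
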